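(* Let $M$ be a complete properly immersed translator in $\mathbb{H}^2\times\mathbb{R}$. For each choice of sign $\pm$ the following holds. Let $\alpha^\pm\subset\partial_\infty^\pm M\subset\mathbb{H}^2\times\{\pm\infty\}$ be a properly embedded arc in the horizontal asymptotic boundary of $M$ such that $$\overline{\partial_\infty^\pm M\setminus\alpha^\pm}\,\cap\,\alpha^\pm=\emptyset$$ and such that $M\cup\alpha^\pm$ is a continuous surface with boundary. Then $\alpha^\pm$ is a geodesic arc in $\mathbb{H}^2\times\{\pm\infty\}$ (identified with $\mathbb{H}^2$).
   Context: Translators. $\mathbb{H}^2$ is the hyperbolic plane with ideal boundary $\partial_\infty\mathbb{H}^2$, and $\mathbb{H}^2\times\mathbb{R}$ carries the product metric; $\partial_h$ is the unit coordinate vector field of the factor $\mathbb{R}$. A translator is an immersed surface $M$ in $\mathbb{H}^2\times\mathbb{R}$ satisfying $H=\langle N,\partial_h\rangle$, where $N$ is the unit normal and $H$ the mean curvature with respect to $N$, i.e. the mean curvature vector (trace of the second fundamental form) is $\vec H=HN$. Asymptotic boundary. The boundary at infinity of $\mathbb{H}^2\times\mathbb{R}$ is $\partial_\infty(\mathbb{H}^2\times\mathbb{R})=[\partial_\infty\mathbb{H}^2\times\mathbb{R}]\cup[\mathbb{H}^2\times\{\pm\infty\}]\cup[\partial_\infty\mathbb{H}^2\times\{\pm\infty\}]$. A sequence $p_n=(x_n,t_n)$ in $\mathbb{H}^2\times\mathbb{R}$ converges to $(x,t)\in\partial_\infty(\mathbb{H}^2\times\mathbb{R})$ if $x_n\to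 x$ in $\mathbb{H}^2\cup\partial_\infty\mathbb{H}^2$ (Euclidean convergence in the closed Poincaré disc) and $t_n\to t$ in $[-\infty,+\infty]$. For $A\subset\mathbb{H}^2\times\mathbb{R}$, the asymptotic boundary $\partial_\infty A$ is the set of points of $\partial_\infty(\mathbb{H}^2\times\mathbb{R})$ that are limits of sequences of points of $A$. Its positive/negative horizontal part is $\partial_\infty^{\pm}A=\partial_\infty A\cap(\mathbb{H}^2\times\{\pm\infty\})$. Convention. That $M\cup\alpha^\pm$ is a continuous surface with boundary is meant with respect to the topology of the compactification just described, with $\alpha^\pm$ being boundary. *)

theory Defs
  imports "HOL-Analysis.Analysis"
begin

section \<open>Smooth maps\<close>

text \<open>Only used for open \<open>S\<close>, where the Frechet derivative at a point of \<open>S\<close> depends only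
  on the values on \<open>S\<close>.\<close>

primrec Ck_on :: "nat \<Rightarrow> 'a::euclidean_space set \<Rightarrow> ('a \<Rightarrow> 'b::real_normed_vector) \<Rightarrow> bool" where
  "Ck_on 0 S f \<longleftrightarrow> continuous_on S f"
| "Ck_on (Suc k) S f \<longleftrightarrow> (\<forall>x\<in>S. f differentiable (at x)) \<and>
     (\<forall>v. Ck_on k S (\<lambda>x. frechet_derivative f (at x) v))"

definition smooth_on :: "'a::euclidean_space set \<Rightarrow> ('a \<Rightarrow> 'b::real_normed_vector) \<Rightarrow> bool" where
  "smooth_on S f \<longleftrightarrow> (\<forall>k. Ck_on k S f)"

section \<open>Riemannian metrics on open subsets of a Euclidean space\<close>

type_synonym 'v riem_metric = "'v \<Rightarrow> 'v \<Rightarrow> 'v \<Rightarrow> real"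

definition dmetric :: "'v::euclidean_space riem_metric \<Rightarrow> 'v \<Rightarrow> 'v \<Rightarrow> 'v \<Rightarrow> 'v \<Rightarrow> real" where
  "dmetric g p u v w = frechet_derivative (\<lambda>q. g q v w) (at p) u"

text \<open>Koszul's formula for constant vector fields: \<open>christoffel g p v w\<close> is the value at \<open>p\<close> of the
  Levi-Civita derivative of the constant field \<open>w\<close> in direction \<open>v\<close>.\<close>

definition christoffel :: "'v::euclidean_space riem_metric \<Rightarrow> 'v \<Rightarrow> 'v \<Rightarrow> 'v \<Rightarrow> 'v" where
  "christoffel g p v w =
     (THE c. \<forall>u. g p c u = (dmetric g p v w u + dmetric g p w v u - dmetric g p u v w) / 2)"

definition is_geodesic :: "'v::euclidean_space riem_metric \<Rightarrow> 'v set \<Rightarrow> real set \<Rightarrow> (real \<Rightarrow> 'v) \<Rightarrow> bool" where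
  "is_geodesic g D I \<gamma> \<longleftrightarrow> \<gamma> ` I \<subseteq> D \<and>
     (\<exists>\<gamma>'. \<forall>t\<in>I. \<gamma>' t \<noteq> 0 \<and>
        (\<gamma> has_vector_derivative \<gamma>' t) (at t within I) \<and>
        (\<gamma>' has_vector_derivative - christoffel g (\<gamma> t) (\<gamma>' t) (\<gamma>' t)) (at t within I))"

definition nontrivial_interval :: "real set \<Rightarrow> bool" where
  "nontrivial_interval I \<longleftrightarrow> is_interval I \<and> (\<exists>a\<in>I. \<exists>b\<in>I. a < b)"

definition geodesic_arc :: "'v::euclidean_space riem_metric \<Rightarrow> 'v set \<Rightarrow> 'v set \<Rightarrow> bool" where
  "geodesic_arc g D C \<longleftrightarrow> (\<exists>I \<gamma>. nontrivial_interval I \<and> is_geodesic g D I \<gamma> \<and> C = \<gamma> ` I)"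

section \<open>The hyperbolic plane and its product with the line\<close>

text \<open>Poincare disc model.\<close>

definition H2 :: "complex set" where
  "H2 = ball 0 1"

definition H2_metric :: "complex riem_metric" where
  "H2_metric z v w = 4 / (1 - (norm z)\<^sup>2)\<^sup>2 * (v \<bullet> w)"

definition H2R :: "(complex \<times> real) set" where
  "H2R = H2 \<times> UNIV"

definition H2R_metric :: "(complex \<times> real) riem_metric" where
  "H2R_metric p v w = H2_metric (fst p) (fst v) (fst w) + snd v * snd w"

definition vertical_field :: "complex \<times> real" where
  "vertical_field = (0, 1)"

section \<open>Immersed surfaces\<close>

text \<open>A smooth surface is a space \<open>S\<close> with a family of local parametrizations by open subsets of
  the plane; completing the family to a maximal atlas changes none of the notions below.\<close>

type_synonym 'a parametrizations = "((real^2) set \<times> (real^2 \<Rightarrow> 'a)) set"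

definition smooth_surface :: "'a topology \<Rightarrow> 'a parametrizations \<Rightarrow> bool" where
  "smooth_surface S \<A> \<longleftrightarrow> Hausdorff_space S \<and> second_countable S \<and>
     (\<forall>(W,\<psi>)\<in>\<A>. open W \<and> openin S (\<psi> ` W) \<and>
        homeomorphic_map (top_of_set W) (subtopology S (\<psi> ` W)) \<psi>) \<and>
     (\<Union>(W,\<psi>)\<in>\<A>. \<psi> ` W) = topspace S \<and>
     (\<forall>(W,\<psi>)\<in>\<A>. \<forall>(W',\<psi>')\<in>\<A>.
        smooth_on {u \<in> W. \<psi> u \<in> \<psi>' ` W'} (inv_into W' \<psi>' \<circ> \<psi>))"

definition immersion ::
    "'v::euclidean_space set \<Rightarrow> 'a topology \<Rightarrow> 'a parametrizations \<Rightarrow> ('a \<Rightarrow> 'v) \<Rightarrow> bool" where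
  "immersion D S \<A> F \<longleftrightarrow> F ` topspace S \<subseteq> D \<and>
     (\<forall>(W,\<psi>)\<in>\<A>. smooth_on W (F \<circ> \<psi>) \<and>
        (\<forall>u\<in>W. inj (frechet_derivative (F \<circ> \<psi>) (at u))))"

text \<open>As \<open>F\<close> is an immersion, a continuous curve \<open>c\<close> in \<open>S\<close> is piecewise \<open>C\<^sup>1\<close> iff \<open>F \<circ> c\<close> is, and its
  length in the induced metric is that of \<open>F \<circ> c\<close>. The nonnegative integral is infinite on
  non-rectifiable curves, which the library's notion of piecewise \<open>C\<^sup>1\<close> admits.\<close>

definition curve_length :: "'v::euclidean_space riem_metric \<Rightarrow> (real \<Rightarrow> 'v) \<Rightarrow> ennreal" where
  "curve_length g c =
     (\<integral>\<^sup>+t\<in>{0..1}. ennreal (sqrt (g (c t) (vector_derivative c (at t)) (vector_derivative c (at t)))) \<partial>lborel)"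

definition surface_curve :: "'a topology \<Rightarrow> ('a \<Rightarrow> 'v::euclidean_space) \<Rightarrow> 'a \<Rightarrow> 'a \<Rightarrow> (real \<Rightarrow> 'a) \<Rightarrow> bool" where
  "surface_curve S F p q c \<longleftrightarrow> continuous_map (top_of_set {0..1}) S c \<and> c 0 = p \<and> c 1 = q \<and>
     (F \<circ> c) piecewise_C1_differentiable_on {0..1}"

text \<open>Points in different components have distance \<open>\<infinity>\<close>.\<close>

definition intrinsic_dist ::
    "'v::euclidean_space riem_metric \<Rightarrow> 'a topology \<Rightarrow> ('a \<Rightarrow> 'v) \<Rightarrow> 'a \<Rightarrow> 'a \<Rightarrow> ennreal" where
  "intrinsic_dist g S F p q = (INF c\<in>{c. surface_curve S F p q c}. curve_length g (F \<circ> c))"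

definition complete_immersion ::
    "'v::euclidean_space riem_metric \<Rightarrow> 'a topology \<Rightarrow> ('a \<Rightarrow> 'v) \<Rightarrow> bool" where
  "complete_immersion g S F \<longleftrightarrow>
     (\<forall>x. range x \<subseteq> topspace S \<and>
          (\<forall>e>0. \<exists>N. \<forall>m\<ge>N. \<forall>n\<ge>N. intrinsic_dist g S F (x m) (x n) < e) \<longrightarrow>
          (\<exists>l\<in>topspace S. (\<lambda>n::nat. intrinsic_dist g S F (x n) l) \<longlonglongrightarrow> 0))"

section \<open>Mean curvature and translators\<close>

text \<open>\<open>X\<close> is a local parametrization of the immersed surface in the ambient metric \<open>g\<close>, and the
  tangent vectors \<open>X\<^sub>v\<close> are indexed by \<open>v\<close> in the parameter plane.\<close>

definition dparam :: "(real^2 \<Rightarrow> 'v::euclidean_space) \<Rightarrow> real^2 \<Rightarrow> real^2 \<Rightarrow> 'v" where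
  "dparam X u v = frechet_derivative X (at u) v"

definition first_form :: "'v::euclidean_space riem_metric \<Rightarrow> (real^2 \<Rightarrow> 'v) \<Rightarrow> real^2 \<Rightarrow> real^2^2" where
  "first_form g X u = (\<chi> i j. g (X u) (dparam X u (axis i 1)) (dparam X u (axis j 1)))"

definition unit_normal :: "'v::euclidean_space riem_metric \<Rightarrow> (real^2 \<Rightarrow> 'v) \<Rightarrow> real^2 \<Rightarrow> 'v \<Rightarrow> bool" where
  "unit_normal g X u N \<longleftrightarrow> g (X u) N N = 1 \<and> (\<forall>v. g (X u) N (dparam X u v) = 0)"

text \<open>Levi-Civita derivative of the field \<open>X\<^sub>w\<close> along \<open>X\<close> in direction \<open>X\<^sub>v\<close>.\<close>

definition cov_dparam :: "'v::euclidean_space riem_metric \<Rightarrow> (real^2 \<Rightarrow> 'v) \<Rightarrow> real^2 \<Rightarrow> real^2 \<Rightarrow> real^2 \<Rightarrow> 'v" where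
  "cov_dparam g X u v w = frechet_derivative (\<lambda>x. dparam X x w) (at u) v
     + christoffel g (X u) (dparam X u v) (dparam X u w)"

definition second_form :: "'v::euclidean_space riem_metric \<Rightarrow> (real^2 \<Rightarrow> 'v) \<Rightarrow> real^2 \<Rightarrow> 'v \<Rightarrow> real^2^2" where
  "second_form g X u N = (\<chi> i j. g (X u) (cov_dparam g X u (axis i 1) (axis j 1)) N)"

definition mean_curvature :: "'v::euclidean_space riem_metric \<Rightarrow> (real^2 \<Rightarrow> 'v) \<Rightarrow> real^2 \<Rightarrow> 'v \<Rightarrow> real" where
  "mean_curvature g X u N = trace (matrix_inv (first_form g X u) ** second_form g X u N)"

text \<open>The equation is invariant under \<open>N \<mapsto> -N\<close>, so no orientation is needed.\<close>

definition translator :: "'a topology \<Rightarrow> 'a parametrizations \<Rightarrow> ('a \<Rightarrow> complex \<times> real) \<Rightarrow> bool" where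
  "translator S \<A> F \<longleftrightarrow> smooth_surface S \<A> \<and> immersion H2R S \<A> F \<and>
     (\<forall>(W,\<psi>)\<in>\<A>. \<forall>u\<in>W. \<forall>N. unit_normal H2R_metric (F \<circ> \<psi>) u N \<longrightarrow>
        mean_curvature H2R_metric (F \<circ> \<psi>) u N = H2R_metric (F (\<psi> u)) N vertical_field)"

section \<open>The asymptotic boundary\<close>

text \<open>The compactification is the product of the closed disc with the extended real line,
  as a subspace of \<open>complex \<times> ereal\<close>.\<close>

definition H2R_embed :: "complex \<times> real \<Rightarrow> complex \<times> ereal" where
  "H2R_embed p = (fst p, ereal (snd p))"

definition H2R_infinity :: "(complex \<times> ereal) set" where
  "H2R_infinity = sphere 0 1 \<times> range ereal \<union> H2 \<times> {\<infinity>, -\<infinity>} \<union> sphere 0 1 \<times> {\<infinity>, -\<infinity>}"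

definition asymptotic_boundary :: "(complex \<times> real) set \<Rightarrow> (complex \<times> ereal) set" where
  "asymptotic_boundary A =
     {q \<in> H2R_infinity. \<exists>p. (\<forall>n::nat. p n \<in> A) \<and> (\<lambda>n. H2R_embed (p n)) \<longlonglongrightarrow> q}"

text \<open>\<open>\<sigma>\<close> is \<open>\<infinity>\<close> or \<open>-\<infinity>\<close>.\<close>

definition horizontal_boundary :: "ereal \<Rightarrow> (complex \<times> real) set \<Rightarrow> (complex \<times> ereal) set" where
  "horizontal_boundary \<sigma> A = asymptotic_boundary A \<inter> H2 \<times> {\<sigma>}"

text \<open>An injective proper map into a Hausdorff space is an embedding with closed image.\<close>

definition properly_embedded_arc :: "'b::topological_space set \<Rightarrow> 'b set \<Rightarrow> bool" where
  "properly_embedded_arc Y C \<longleftrightarrow> (\<exists>I c. nontrivial_interval I \<and>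
     continuous_map (top_of_set I) (top_of_set Y) c \<and> proper_map (top_of_set I) (top_of_set Y) c \<and>
     inj_on c I \<and> C = c ` I)"

section \<open>Topological surfaces with boundary\<close>

definition half_plane :: "(real^2) set" where
  "half_plane = {v. v $ 2 \<ge> 0}"

definition half_plane_chart :: "'a topology \<Rightarrow> 'a set \<Rightarrow> ('a \<Rightarrow> real^2) \<Rightarrow> bool" where
  "half_plane_chart T U \<phi> \<longleftrightarrow> openin T U \<and> openin (top_of_set half_plane) (\<phi> ` U) \<and>
     homeomorphic_map (subtopology T U) (top_of_set (\<phi> ` U)) \<phi>"

definition surface_with_boundary :: "'a topology \<Rightarrow> bool" where
  "surface_with_boundary T \<longleftrightarrow> Hausdorff_space T \<and> second_countable T \<and>
     (\<forall>x\<in>topspace T. \<exists>U \<phi>. half_plane_chart T U \<phi> \<and> x \<in> U)"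

definition surface_boundary :: "'a topology \<Rightarrow> 'a set" where
  "surface_boundary T = {x. \<exists>U \<phi>. half_plane_chart T U \<phi> \<and> x \<in> U \<and> \<phi> x $ 2 = 0}"

text \<open>The topology of the disjoint union of \<open>S\<close> and \<open>\<alpha>\<close> in which \<open>S\<close> is open with its own topology,
  and neighbourhoods of points of \<open>\<alpha>\<close> are induced from the compactification through \<open>F\<close>. If \<open>F\<close> is a
  proper embedding, this is the subspace \<open>F(S) \<union> \<alpha>\<close> of the compactification. It is phrased on the
  disjoint union, not on the image, because \<open>F\<close> may have self-intersections.\<close>

definition surface_at_infinity ::
    "'a topology \<Rightarrow> ('a \<Rightarrow> complex \<times> real) \<Rightarrow> (complex \<times> ereal) set \<Rightarrow> ('a + complex \<times> ereal) topology" where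
  "surface_at_infinity S F \<alpha> = topology_generated_by
     ({Inl ` U |U. openin S U} \<union>
      {{x \<in> topspace S <+> \<alpha>. case_sum (H2R_embed \<circ> F) id x \<in> V} |V. open V})"

definition continuous_surface_with_boundary ::
    "'a topology \<Rightarrow> ('a \<Rightarrow> complex \<times> real) \<Rightarrow> (complex \<times> ereal) set \<Rightarrow> bool" where
  "continuous_surface_with_boundary S F \<alpha> \<longleftrightarrow>
     surface_with_boundary (surface_at_infinity S F \<alpha>) \<and>
     surface_boundary (surface_at_infinity S F \<alpha>) = Inr ` \<alpha>"

end

theory Submission
  imports Defs
begin

text \<open>If the arc is not contained in a geodesic, then for two of its points the linear functional \<open>\<l>\<close> of
  the hyperboloid model that vanishes on the geodesic through them takes, up to sign, a positive maximum
  \<open>m\<close> over the subarc in between. The restriction of \<open>\<l>\<close> to the hyperbolic plane satisfies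
  \<open>Hess \<l> = \<l> g\<close>, so it is strictly convex near the points where the maximum is attained. Over a small
  neighbourhood of these points the translator at large heights is close to the arc, hence \<open>\<l>\<close> is at most
  slightly larger than \<open>m\<close> there, and the translator has points of every large height at which \<open>\<l>\<close> is
  close to \<open>m\<close>. Therefore \<open>\<l>(x) - c (t - t\<^sub>0)\<^sup>2\<close> with small \<open>c\<close> has an interior local maximum
  on the translator in a slab around a large height \<open>t\<^sub>0\<close>. At that maximum the equation
  \<open>H = \<langle>N, \<partial>\<^sub>h\<rangle>\<close> forces \<open>\<l> \<le> 4c\<close>, a contradiction.\<close>

section \<open>Levi-Civita connections of the disc and of the product\<close>

lemma H2_norm: "z \<in> H2 \<longleftrightarrow> norm z < 1"
  by (simp add: H2_def)

lemma H2_pos: "z \<in> H2 \<Longrightarrow> 1 - (norm z)\<^sup>2 > 0"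
  by (simp add: H2_norm abs_square_less_1)

lemma has_derivative_conformal_factor:
  fixes z :: "'a::real_inner"
  assumes "(norm z)\<^sup>2 \<noteq> 1"
  shows "((\<lambda>z. 4 / (1 - (norm z)\<^sup>2)\<^sup>2) has_derivative (\<lambda>u. 16 * (z \<bullet> u) / (1 - (norm z)\<^sup>2)^3)) (at z)"
proof -
  have 1: "((\<lambda>z. 1 - z \<bullet> z) has_derivative (\<lambda>u. - 2 * (z \<bullet> u))) (at z)"
    by (rule has_derivative_eq_rhs, (rule derivative_intros)+) (simp add: fun_eq_iff inner_commute)
  have 2: "((\<lambda>D. 4 / D\<^sup>2) has_real_derivative - 8 / D^3) (at D)" if "D \<noteq> 0" for D :: real
    using that by (auto intro!: derivative_eq_intros simp: divide_simps power2_eq_square power3_eq_cube)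
  from has_derivative_compose[OF 1 2[unfolded has_field_derivative_def]] assms
  show ?thesis by (simp add: power2_norm_eq_inner)
qed

text \<open>The second assumption is the nondegeneracy of \<open>g p\<close>; it supplies the
  uniqueness demanded by the definite description in Koszul's formula.\<close>

lemma christoffel_eqI:
  assumes "\<And>u. g p c u = (dmetric g p v w u + dmetric g p w v u - dmetric g p u v w) / 2"
    and "\<And>c'. (\<And>u. g p c' u = g p c u) \<Longrightarrow> c' = c"
  shows "christoffel g p v w = c"
  unfolding christoffel_def proof (rule the_equality)
  show "\<forall>u. g p c u = (dmetric g p v w u + dmetric g p w v u - dmetric g p u v w) / 2"
    using assms(1) by blast
  show "c' = c" if "\<forall>u. g p c' u = (dmetric g p v w u + dmetric g p w v u - dmetric g p u v w) / 2" for c'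
    by (rule assms(2)) (simp only: assms(1) that)
qed

lemma dmetric_H2:
  assumes "z \<in> H2"
  shows "dmetric H2_metric z u v w = 16 * (z \<bullet> u) / (1 - (norm z)\<^sup>2)^3 * (v \<bullet> w)"
proof -
  have "((\<lambda>z. H2_metric z v w) has_derivative
      (\<lambda>u. 16 * (z \<bullet> u) / (1 - (norm z)\<^sup>2)^3 * (v \<bullet> w))) (at z)"
    unfolding H2_metric_def
    by (rule has_derivative_mult_left, rule has_derivative_conformal_factor)
      (use H2_pos[OF assms] in auto)
  from frechet_derivative_at[OF this, symmetric] show ?thesis by (simp add: dmetric_def)
qed

lemma H2R_iff: "p \<in> H2R \<longleftrightarrow> fst p \<in> H2"
  by (cases p) (auto simp: H2R_def)

lemma dmetric_H2R:
  assumes "fst p \<in> H2"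
  shows "dmetric H2R_metric p u v w
     = 16 * (fst p \<bullet> fst u) / (1 - (norm (fst p))\<^sup>2)^3 * (fst v \<bullet> fst w)"
proof -
  have 1: "((\<lambda>z. 4 / (1 - (norm z)\<^sup>2)\<^sup>2) has_derivative
       (\<lambda>u. 16 * (fst p \<bullet> u) / (1 - (norm (fst p))\<^sup>2)^3)) (at (fst p) within range fst)"
    using has_derivative_conformal_factor[of "fst p"] H2_pos[OF assms]
    by (auto intro: has_derivative_at_withinI)
  have 2: "((\<lambda>p. 4 / (1 - (norm (fst p))\<^sup>2)\<^sup>2) has_derivative
       (\<lambda>u. 16 * (fst p \<bullet> fst u) / (1 - (norm (fst p))\<^sup>2)^3)) (at p)"
    using has_derivative_in_compose[OF has_derivative_fst[OF has_derivative_ident] 1]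
    by simp
  have "((\<lambda>p. H2R_metric p v w) has_derivative
      (\<lambda>u. 16 * (fst p \<bullet> fst u) / (1 - (norm (fst p))\<^sup>2)^3 * (fst v \<bullet> fst w) + 0)) (at p)"
    unfolding H2R_metric_def H2_metric_def
    by (rule has_derivative_add[OF has_derivative_mult_left[OF 2] has_derivative_const])
  from frechet_derivative_at[OF this, symmetric] show ?thesis by (simp add: dmetric_def)
qed

text \<open>Connection of the conformal metric \<open>exp (2 f)\<close> times the Euclidean one,
  with \<open>exp f = 2 / (1 - |z|^2)\<close>: it is
  \<open>v(f) w + w(f) v - (v \<bullet> w) grad f\<close>, where
  \<open>grad f = 2 z / (1 - |z|^2)\<close>.\<close>

definition H2_gamma :: "complex \<Rightarrow> complex \<Rightarrow> complex \<Rightarrow> complex" where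
  "H2_gamma z v w = (2 / (1 - (norm z)\<^sup>2)) *\<^sub>R ((z \<bullet> v) *\<^sub>R w + (z \<bullet> w) *\<^sub>R v - (v \<bullet> w) *\<^sub>R z)"

lemma H2_metric_gamma:
  assumes "z \<in> H2"
  shows "H2_metric z (H2_gamma z v w) u =
    8 / (1 - (norm z)\<^sup>2)^3 * ((z \<bullet> v) * (w \<bullet> u) + (z \<bullet> w) * (v \<bullet> u) - (z \<bullet> u) * (v \<bullet> w))"
  unfolding H2_metric_def H2_gamma_def
  by (simp add: inner_diff_left inner_add_left power2_eq_square power3_eq_cube mult_ac)

lemma christoffel_H2:
  assumes "z \<in> H2"
  shows "christoffel H2_metric z v w = H2_gamma z v w"
proof (rule christoffel_eqI)
  show "H2_metric z (H2_gamma z v w) u =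
      (dmetric H2_metric z v w u + dmetric H2_metric z w v u - dmetric H2_metric z u v w) / 2" for u
    unfolding H2_metric_gamma[OF assms] dmetric_H2[OF assms]
    by (simp add: diff_divide_distrib add_divide_distrib algebra_simps)
next
  fix c' assume "\<And>u. H2_metric z c' u = H2_metric z (H2_gamma z v w) u"
  then have "c' \<bullet> u = H2_gamma z v w \<bullet> u" for u
    using H2_pos[OF assms] by (simp add: H2_metric_def)
  then show "c' = H2_gamma z v w" by (metis vector_eq_rdot)
qed

lemma christoffel_H2R:
  assumes "fst p \<in> H2"
  shows "christoffel H2R_metric p v w = (H2_gamma (fst p) (fst v) (fst w), 0)"
proof (rule christoffel_eqI)
  show "H2R_metric p (H2_gamma (fst p) (fst v) (fst w), 0) u =
      (dmetric H2R_metric p v w u + dmetric H2R_metric p w v u - dmetric H2R_metric p u v w) / 2" for u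
    unfolding H2R_metric_def fst_conv snd_conv H2_metric_gamma[OF assms] dmetric_H2R[OF assms]
    by (simp add: diff_divide_distrib add_divide_distrib algebra_simps)
next
  let ?c = "(H2_gamma (fst p) (fst v) (fst w), 0::real)"
  fix c' assume *: "\<And>u. H2R_metric p c' u = H2R_metric p ?c u"
  have "fst c' \<bullet> u = fst ?c \<bullet> u" for u
    using *[of "(u,0)"] H2_pos[OF assms] by (simp add: H2_metric_def H2R_metric_def)
  then have "fst c' = fst ?c" by (metis vector_eq_rdot)
  moreover have "snd c' = snd ?c"
    using *[of "(0,1)"] by (simp add: H2_metric_def H2R_metric_def)
  ultimately show "c' = ?c" by (simp add: prod_eq_iff)
qed

section \<open>Linear functionals of the hyperboloid model\<close>

text \<open>The point of the hyperboloid over \<open>z\<close> is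
  \<open>(1 + |z|^2, 2 z) / (1 - |z|^2)\<close>; \<open>a\<close> and \<open>k\<close> are the time
  and space coefficients of the functional. It is spacelike, with a geodesic as zero set, when
  \<open>a^2 < |k|^2\<close>.\<close>

definition ell :: "real \<Rightarrow> complex \<Rightarrow> complex \<Rightarrow> real" where
  "ell a k z = (a * (1 + (norm z)\<^sup>2) + 2 * (k \<bullet> z)) / (1 - (norm z)\<^sup>2)"

text \<open>The Euclidean gradient of \<open>ell a k\<close>, so that derivatives along curves are
  plain inner products.\<close>

definition dell :: "real \<Rightarrow> complex \<Rightarrow> complex \<Rightarrow> complex" where
  "dell a k z = (2 / (1 - (norm z)\<^sup>2)) *\<^sub>R k +
     (4 * (k \<bullet> z + a) / (1 - (norm z)\<^sup>2)\<^sup>2) *\<^sub>R z"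

lemma has_real_derivative_inner:
  fixes x y :: "real \<Rightarrow> 'a::real_inner"
  assumes "(x has_vector_derivative x') (at s)" "(y has_vector_derivative y') (at s)"
  shows "((\<lambda>s. x s \<bullet> y s) has_real_derivative x s \<bullet> y' + x' \<bullet> y s) (at s)"
  using has_derivative_inner[OF assms[unfolded has_vector_derivative_def]]
  unfolding has_field_derivative_def
  by (rule has_derivative_eq_rhs) (simp add: fun_eq_iff distrib_left mult.commute)

lemma ell_has_derivative:
  fixes x :: "real \<Rightarrow> complex"
  assumes "(x has_vector_derivative x') (at s)" "x s \<in> H2"
  shows "((\<lambda>s. ell a k (x s)) has_real_derivative dell a k (x s) \<bullet> x') (at s)"
proof -
  define p r c d where "p = x s \<bullet> x s" and "r = x s \<bullet> x'" and "c = k \<bullet> x s" and "d = k \<bullet> x'"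
  have D: "1 - p > 0" using H2_pos[OF assms(2)] by (simp add: p_def power2_norm_eq_inner)
  have 1: "((\<lambda>s. x s \<bullet> x s) has_real_derivative 2 * r) (at s)"
    using has_real_derivative_inner[OF assms(1) assms(1)] by (simp add: r_def inner_commute)
  have 2: "((\<lambda>s. k \<bullet> x s) has_real_derivative d) (at s)"
    using has_real_derivative_inner[OF has_vector_derivative_const assms(1), of k] by (simp add: d_def)
  have "((\<lambda>s. (a * (1 + x s \<bullet> x s) + 2 * (k \<bullet> x s)) / (1 - x s \<bullet> x s)) has_real_derivative 
      ((a * (2 * r) + 2 * d) * (1 - p) - (a * (1 + p) + 2 * c) * (- 2 * r)) / (1 - p)\<^sup>2) (at s)"
    using D by (auto intro!: derivative_eq_intros 1 2 simp: p_def c_def power2_eq_square)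
  moreover have "((a * (2 * r) + 2 * d) * (1 - p) - (a * (1 + p) + 2 * c) * (- 2 * r)) / (1 - p)\<^sup>2
     = 2 / (1 - p) * d + 4 * (c + a) / (1 - p)\<^sup>2 * r"
    using D by (simp add: divide_simps) algebra
  ultimately show ?thesis
    by (simp add: ell_def dell_def power2_norm_eq_inner inner_add_left p_def r_def c_def d_def)
qed

text \<open>The restriction of a linear functional to the hyperboloid has Hessian
  \<open>Hess \<l> = \<l> g\<close>, which is read off along a curve \<open>x\<close> with velocity \<open>y\<close>.\<close>

lemma dell_has_derivative:
  fixes x y :: "real \<Rightarrow> complex"
  assumes "(x has_vector_derivative y s) (at s)" "(y has_vector_derivative y') (at s)" "x s \<in> H2"
  shows "((\<lambda>s. dell a k (x s) \<bullet> y s) has_real_derivative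
     ell a k (x s) * H2_metric (x s) (y s) (y s) + dell a k (x s) \<bullet> (y' + H2_gamma (x s) (y s) (y s))) (at s)"
proof -
  define p r c d w e g where "p = x s \<bullet> x s" and "r = x s \<bullet> y s" and "c = k \<bullet> x s" and "d = k \<bullet> y s"
    and "w = y s \<bullet> y s" and "e = k \<bullet> y'" and "g = x s \<bullet> y'"
  have D: "1 - p > 0" using H2_pos[OF assms(3)] by (simp add: p_def power2_norm_eq_inner)
  have 1: "((\<lambda>s. x s \<bullet> x s) has_real_derivative 2 * r) (at s)"
    using has_real_derivative_inner[OF assms(1) assms(1)] by (simp add: r_def inner_commute)
  have 2: "((\<lambda>s. k \<bullet> x s) has_real_derivative d) (at s)"
    using has_real_derivative_inner[OF has_vector_derivative_const assms(1), of k] by (simp add: d_def)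
  have 3: "((\<lambda>s. k \<bullet> y s) has_real_derivative e) (at s)"
    using has_real_derivative_inner[OF has_vector_derivative_const assms(2), of k] by (simp add: e_def)
  have 4: "((\<lambda>s. x s \<bullet> y s) has_real_derivative g + w) (at s)"
    using has_real_derivative_inner[OF assms(1,2)] by (simp add: g_def w_def)
  have 5: "((\<lambda>s. 2 / (1 - x s \<bullet> x s)) has_real_derivative 4 * r / (1 - p)\<^sup>2) (at s)"
    using D by (auto intro!: derivative_eq_intros 1 simp: p_def power2_eq_square)
  have 6: "((\<lambda>s. 4 / (1 - x s \<bullet> x s)\<^sup>2) has_real_derivative 16 * r / (1 - p)^3) (at s)"
    using D by (auto intro!: derivative_eq_intros 1 simp: p_def power2_eq_square power3_eq_cube divide_simps)
  have 7: "((\<lambda>s. 2 / (1 - x s \<bullet> x s) * (k \<bullet> y s) +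
     (4 / (1 - x s \<bullet> x s)\<^sup>2) * ((k \<bullet> x s + a) * (x s \<bullet> y s))) has_real_derivative 
     (4 * r / (1 - p)\<^sup>2 * d + e * (2 / (1 - p)))
      + (16 * r / (1 - p)^3 * ((c + a) * r) + (d * r + (g + w) * (c + a)) * (4 / (1 - p)\<^sup>2))) (at s)"
    using DERIV_add[OF DERIV_mult[OF 5 3] DERIV_mult[OF 6 DERIV_mult[OF DERIV_add[OF 2 DERIV_const[of a]] 4]]]
    by (simp only: p_def c_def d_def r_def add_0_right)
  have 8: "(4 * r / (1 - p)\<^sup>2 * d + e * (2 / (1 - p)))
      + (16 * r / (1 - p)^3 * ((c + a) * r) + (d * r + (g + w) * (c + a)) * (4 / (1 - p)\<^sup>2))
    = (a * (1 + p) + 2 * c) / (1 - p) * (4 / (1 - p)\<^sup>2 * w)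
      + (2 / (1 - p) * (e + 2 / (1 - p) * (r * d + r * d - w * c))
       + 4 / (1 - p)\<^sup>2 * ((c + a) * (g + 2 / (1 - p) * (r * r + r * r - w * p))))"
  proof -
    \<comment> \<open>Written in \<open>D\<close>, all denominators are powers of one variable, and
      clearing them leaves a polynomial identity.\<close>
    define D where "D = 1 - p"
    have p: "p = 1 - D" and "D \<noteq> 0" using D by (auto simp: D_def)
    then show ?thesis unfolding p
      by (simp add: divide_simps power2_eq_square power3_eq_cube) algebra
  qed
  have *: "dell a k z \<bullet> v = 2 / (1 - z \<bullet> z) * (k \<bullet> v) + 4 / (1 - z \<bullet> z)\<^sup>2 * ((k \<bullet> z + a) * (z \<bullet> v))"
    for z v by (simp add: dell_def power2_norm_eq_inner inner_add_left)
  have **: "v \<bullet> (y' + H2_gamma (x s) (y s) (y s))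
      = v \<bullet> y' + 2 / (1 - p) * (r * (v \<bullet> y s) + r * (v \<bullet> y s) - w * (v \<bullet> x s))" for v
    by (simp only: H2_gamma_def power2_norm_eq_inner inner_add_right inner_diff_right inner_scaleR_right
        p_def r_def w_def)
  from 7 8 show ?thesis
    unfolding * **[of k] **[of "x s"]
    by (simp only: ell_def H2_metric_def power2_norm_eq_inner p_def r_def c_def d_def w_def e_def g_def)
qed

text \<open>At a critical point \<open>(a, k)\<close> would be a multiple of
  \<open>(1 + |z|^2, - 2 z)\<close>, hence timelike or zero.\<close>

lemma dell_nonzero:
  assumes "a\<^sup>2 < (norm k)\<^sup>2" "z \<in> H2"
  shows "dell a k z \<noteq> 0"
proof
  define D q where "D = 1 - (norm z)\<^sup>2" and "q = 2 * (k \<bullet> z + a) / D"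
  have D: "D > 0" using H2_pos[OF assms(2)] by (simp add: D_def)
  assume "dell a k z = 0"
  then have "(2 / D) *\<^sub>R k + (2 / D * q) *\<^sub>R z = 0"
    by (simp add: dell_def D_def q_def power2_eq_square)
  then have "(2 / D) *\<^sub>R (k + q *\<^sub>R z) = 0"
    by (simp add: scaleR_add_right)
  then have k: "k = - q *\<^sub>R z" using D by (simp add: eq_neg_iff_add_eq_0)
  have "q * D = 2 * (k \<bullet> z + a)" using D by (simp add: q_def)
  then have a: "2 * a = q * (1 + (norm z)\<^sup>2)"
    unfolding k by (simp add: D_def power2_norm_eq_inner algebra_simps)
  have "4 * a\<^sup>2 = q\<^sup>2 * (1 + (norm z)\<^sup>2)\<^sup>2" 
    using arg_cong[OF a, of "\<lambda>x. x\<^sup>2"] by (simp add: power_mult_distrib)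
  also have "\<dots> = q\<^sup>2 * D\<^sup>2 + 4 * (q\<^sup>2 * (norm z)\<^sup>2)" by (simp add: D_def) algebra
  also have "q\<^sup>2 * (norm z)\<^sup>2 = (norm k)\<^sup>2" by (simp add: k power_mult_distrib)
  finally show False using assms(1) mult_nonneg_nonneg[OF zero_le_power2 zero_le_power2, of q D] by linarith
qed

lemma continuous_on_ell: "continuous_on H2 (ell a k)"
proof -
  have "ell a k = (\<lambda>z. (a * (1 + (norm z)\<^sup>2) + 2 * (k \<bullet> z)) / (1 - (norm z)\<^sup>2))"
    by (simp add: fun_eq_iff ell_def)
  then show ?thesis
    using H2_pos by (simp only:) (intro continuous_intros, force)
qed

section \<open>Mean curvature at an interior maximum\<close>

text \<open>A positive second derivative at \<open>0\<close> makes \<open>k1\<close> positive just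
  to the right of \<open>0\<close>, and the mean value theorem then lifts \<open>k\<close> above its
  maximum. Only the existence of \<open>k2\<close> at the single point \<open>0\<close>
  enters.\<close>

lemma DERIV_second_local_max:
  fixes k k1 :: "real \<Rightarrow> real"
  assumes "d > 0" and k: "\<And>s. \<bar>s\<bar> < d \<Longrightarrow> (k has_real_derivative k1 s) (at s)"
    and k1: "(k1 has_real_derivative k2) (at 0)" and max: "\<And>s. \<bar>s\<bar> < d \<Longrightarrow> k s \<le> k 0"
  shows "k1 0 = 0" and "k2 \<le> 0"
proof -
  show k10: "k1 0 = 0"
    using DERIV_local_max[OF k[of 0] \<open>d > 0\<close>] max \<open>d > 0\<close> by auto
  show "k2 \<le> 0"
  proof (rule ccontr)
    assume "\<not> k2 \<le> 0"
    then obtain e where e: "e > 0" "\<And>h. 0 < h \<Longrightarrow> h < e \<Longrightarrow> k1 0 < k1 h"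
      using DERIV_pos_inc_right[OF k1] by auto
    define h where "h = min (d/2) (e/2)"
    have h: "0 < h" "h < d" "h < e" using \<open>d > 0\<close> e(1) by (auto simp: h_def)
    have "\<exists>z. 0 < z \<and> z < h \<and> k h - k 0 = (h - 0) * k1 z"
      using h by (intro MVT2) (auto intro: k)
    then obtain z where z: "0 < z" "z < h" "k h - k 0 = h * k1 z" by auto
    have "k1 z > 0" using e(2)[of z] z h k10 by auto
    then have "k h > k 0" using z(3) h mult_pos_pos[of h "k1 z"] by linarith
    then show False using max[of h] h by auto
  qed
qed

text \<open>Cramer's rule. Multiplied by the determinant, the mean curvature becomes a polynomial in
  the entries of the two fundamental forms.\<close>

lemma trace_matrix_inv_2:
  fixes A B :: "real^2^2"
  assumes D: "A$1$1 * A$2$2 - A$1$2 * A$2$1 \<noteq> 0"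
  shows "trace (matrix_inv A ** B) * (A$1$1 * A$2$2 - A$1$2 * A$2$1) =
    A$2$2 * B$1$1 - A$1$2 * B$2$1 - A$2$1 * B$1$2 + A$1$1 * B$2$2"
proof -
  define d where "d = A$1$1 * A$2$2 - A$1$2 * A$2$1"
  define C where "C = (vector [vector [A$2$2 / d, - A$1$2 / d], vector [- A$2$1 / d, A$1$1 / d]] :: real^2^2)"
  have C: "C$1$1 = A$2$2 / d" "C$1$2 = - A$1$2 / d" "C$2$1 = - A$2$1 / d" "C$2$2 = A$1$1 / d"
    by (simp_all add: C_def)
  have d: "d \<noteq> 0" using D by (simp add: d_def)
  have "C ** A = mat 1" "A ** C = mat 1"
    using d by (auto simp: vec_eq_iff matrix_matrix_mult_def forall_2 sum_2 C mat_def divide_simps)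
      (auto simp: d_def algebra_simps)
  then have "A ** matrix_inv A = mat 1"
    unfolding matrix_inv_def by (metis (mono_tags, lifting) someI_ex)
  then have "matrix_inv A = C"
    by (metis \<open>C ** A = mat 1\<close> matrix_mul_assoc matrix_mul_lid matrix_mul_rid)
  then show ?thesis
    using d unfolding d_def[symmetric]
    by (simp add: trace_def matrix_matrix_mult_def sum_2 C field_simps)
qed

section \<open>The product metric on tangent planes and covariant derivatives along
  parametrizations\<close>

lemma H2R_metric_simps:
  "H2R_metric p (v + v') w = H2R_metric p v w + H2R_metric p v' w"
  "H2R_metric p (v - v') w = H2R_metric p v w - H2R_metric p v' w"
  "H2R_metric p (r *\<^sub>R v) w = r * H2R_metric p v w"
  "H2R_metric p w (v + v') = H2R_metric p w v + H2R_metric p w v'"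
  "H2R_metric p w (v - v') = H2R_metric p w v - H2R_metric p w v'"
  "H2R_metric p w (r *\<^sub>R v) = r * H2R_metric p w v"
  by (simp_all add: H2R_metric_def H2_metric_def algebra_simps inner_diff_left inner_diff_right
      add_divide_distrib diff_divide_distrib)

lemma H2R_metric_commute: "H2R_metric p v w = H2R_metric p w v"
  by (simp add: H2R_metric_def H2_metric_def inner_commute mult.commute)

lemma H2R_metric_pos:
  assumes "fst p \<in> H2" "v \<noteq> 0"
  shows "H2R_metric p v v > 0"
proof -
  have "4 / (1 - (norm (fst p))\<^sup>2)\<^sup>2 > 0" using H2_pos[OF assms(1)] by auto
  then have "H2R_metric p v v \<ge> 0" and "H2R_metric p v v = 0 \<longleftrightarrow> fst v = 0 \<and> snd v = 0"
    unfolding H2R_metric_def H2_metric_def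
    by (auto simp: add_nonneg_eq_0_iff)
  moreover have "\<not> (fst v = 0 \<and> snd v = 0)" using assms(2) by (auto simp: prod_eq_iff)
  ultimately show ?thesis by linarith
qed

text \<open>The component of \<open>v\<close> orthogonal to \<open>w\<close> is nonzero; its squared
  length times \<open>g w w\<close> is the Gram determinant.\<close>

lemma H2R_metric_Gram_pos:
  assumes p: "fst p \<in> H2" and ind: "\<And>r. v \<noteq> r *\<^sub>R w" and w: "w \<noteq> 0"
  shows "H2R_metric p v v * H2R_metric p w w - (H2R_metric p v w)\<^sup>2 > 0"
proof -
  let ?g = "H2R_metric p"
  have gw: "?g w w > 0" using H2R_metric_pos[OF p w] .
  have "v - (?g v w / ?g w w) *\<^sub>R w \<noteq> 0" using ind by auto
  from H2R_metric_pos[OF p this]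
  have "0 < ?g w w * (?g v v - (?g v w)\<^sup>2 / ?g w w)"
    using gw by (simp add: H2R_metric_simps H2R_metric_commute[of p w v] power2_eq_square)
  then show ?thesis using gw by (simp add: algebra_simps)
qed

text \<open>Divided by a positive Gram determinant, the left side is the squared length of the
  tangential part of the unit vertical field, hence at most \<open>1\<close>. The difference of the
  two sides is \<open>l^2\<close> times the Gram determinant of the horizontal parts, so
  Cauchy-Schwarz applies.\<close>

lemma H2R_metric_vertical_le:
  fixes p :: "complex \<times> real"
  defines "g \<equiv> H2R_metric p"
  shows "g w w * (snd v)\<^sup>2 - 2 * g v w * (snd v * snd w) + g v v * (snd w)\<^sup>2 \<le> g v v * g w w - (g v w)\<^sup>2"
proof -
  define l where "l = 4 / (1 - (norm (fst p))\<^sup>2)\<^sup>2"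
  have g: "g a b = l * (fst a \<bullet> fst b) + snd a * snd b" for a b
    by (simp add: g_def H2R_metric_def H2_metric_def l_def)
  have "(fst v \<bullet> fst w)\<^sup>2 \<le> (fst v \<bullet> fst v) * (fst w \<bullet> fst w)"
    by (rule Cauchy_Schwarz_ineq)
  then have "0 \<le> l\<^sup>2 * ((fst v \<bullet> fst v) * (fst w \<bullet> fst w) - (fst v \<bullet> fst w)\<^sup>2)" by simp
  also have "\<dots> = g v v * g w w - (g v w)\<^sup>2
      - (g w w * (snd v)\<^sup>2 - 2 * g v w * (snd v * snd w) + g v v * (snd w)\<^sup>2)"
    unfolding g by (simp add: power2_eq_square algebra_simps)
  finally show ?thesis by simp
qed

lemma H2_gamma_simps:
  "H2_gamma z (v + v') w = H2_gamma z v w + H2_gamma z v' w"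
  "H2_gamma z (r *\<^sub>R v) w = r *\<^sub>R H2_gamma z v w"
  "H2_gamma z w (v + v') = H2_gamma z w v + H2_gamma z w v'"
  "H2_gamma z w (r *\<^sub>R v) = r *\<^sub>R H2_gamma z w v"
  unfolding H2_gamma_def
  by (simp_all add: inner_add_left inner_add_right scaleR_add_left scaleR_add_right scaleR_diff_right
      mult.commute mult.left_commute)

lemma has_vector_derivative_along_line:
  fixes X :: "real^2 \<Rightarrow> 'v::euclidean_space"
  assumes "X differentiable (at (u + s *\<^sub>R v))"
  shows "((\<lambda>s. X (u + s *\<^sub>R v)) has_vector_derivative dparam X (u + s *\<^sub>R v) v) (at s)"
proof -
  have "((\<lambda>s. u + s *\<^sub>R v) has_vector_derivative v) (at s)"
    by (auto intro!: derivative_eq_intros)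
  moreover have "(X has_derivative dparam X (u + s *\<^sub>R v)) (at (u + s *\<^sub>R v))"
    using assms unfolding dparam_def by (simp add: frechet_derivative_works)
  ultimately show ?thesis
    using vector_derivative_diff_chain_within[of "\<lambda>s. u + s *\<^sub>R v" v s UNIV X] 
    by (auto simp: o_def intro: has_derivative_at_withinI)
qed

lemma dparam_linear:
  assumes "X differentiable (at u)"
  shows "linear (dparam X u)"
  using linear_frechet_derivative[OF assms] by (simp add: dparam_def[abs_def])

text \<open>Linearity in the last argument differentiates an identity between tangent fields, which
  therefore has to hold on the neighbourhood \<open>W\<close> and not only at
  \<open>u\<close>.\<close>

lemma cov_dparam_bilinear:
  assumes W: "open W" "u \<in> W" and X: "\<And>x. x \<in> W \<Longrightarrow> X differentiable (at x)"
    and X2: "\<And>w. (\<lambda>x. dparam X x w) differentiable (at u)"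
    and p: "fst (X u) \<in> H2"
  shows "cov_dparam H2R_metric X u (a *\<^sub>R v + b *\<^sub>R v') w =
      a *\<^sub>R cov_dparam H2R_metric X u v w + b *\<^sub>R cov_dparam H2R_metric X u v' w"
    and "cov_dparam H2R_metric X u w (a *\<^sub>R v + b *\<^sub>R v') =
      a *\<^sub>R cov_dparam H2R_metric X u w v + b *\<^sub>R cov_dparam H2R_metric X u w v'"
proof -
  have lin: "dparam X x (a *\<^sub>R v + b *\<^sub>R v') = a *\<^sub>R dparam X x v + b *\<^sub>R dparam X x v'" if "x \<in> W" for x
    using dparam_linear[OF X[OF that]] by (simp add: linear_add linear_scale)
  have 1: "frechet_derivative (\<lambda>x. dparam X x w) (at u) (a *\<^sub>R v + b *\<^sub>R v') =
     a *\<^sub>R frechet_derivative (\<lambda>x. dparam X x w) (at u) v + b *\<^sub>R frechet_derivative (\<lambda>x. dparam X x w) (at u) v'"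
    using linear_frechet_derivative[OF X2] by (simp add: linear_add linear_scale)
  have "((\<lambda>x. a *\<^sub>R dparam X x v + b *\<^sub>R dparam X x v') has_derivative
     (\<lambda>h. a *\<^sub>R frechet_derivative (\<lambda>x. dparam X x v) (at u) h
        + b *\<^sub>R frechet_derivative (\<lambda>x. dparam X x v') (at u) h)) (at u)"
    by (intro has_derivative_add has_derivative_scaleR_right X2[unfolded frechet_derivative_works])
  then have "((\<lambda>x. dparam X x (a *\<^sub>R v + b *\<^sub>R v')) has_derivative
     (\<lambda>h. a *\<^sub>R frechet_derivative (\<lambda>x. dparam X x v) (at u) h
        + b *\<^sub>R frechet_derivative (\<lambda>x. dparam X x v') (at u) h)) (at u)"
    by (rule has_derivative_transform_within_open[OF _ W]) (simp add: lin)
  from frechet_derivative_at[OF this, symmetric]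
  have 2: "frechet_derivative (\<lambda>x. dparam X x (a *\<^sub>R v + b *\<^sub>R v')) (at u) w =
     a *\<^sub>R frechet_derivative (\<lambda>x. dparam X x v) (at u) w + b *\<^sub>R frechet_derivative (\<lambda>x. dparam X x v') (at u) w"
    by simp
  show "cov_dparam H2R_metric X u (a *\<^sub>R v + b *\<^sub>R v') w =
      a *\<^sub>R cov_dparam H2R_metric X u v w + b *\<^sub>R cov_dparam H2R_metric X u v' w"
    unfolding cov_dparam_def christoffel_H2R[OF p] 1 lin[OF W(2)]
    by (simp add: H2_gamma_simps scaleR_add_right prod_eq_iff)
  show "cov_dparam H2R_metric X u w (a *\<^sub>R v + b *\<^sub>R v') =
      a *\<^sub>R cov_dparam H2R_metric X u w v + b *\<^sub>R cov_dparam H2R_metric X u w v'"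
    unfolding cov_dparam_def christoffel_H2R[OF p] 2 lin[OF W(2)]
    by (simp add: H2_gamma_simps scaleR_add_right prod_eq_iff)
qed

section \<open>The barrier and its second variation on a surface\<close>

definition barrier :: "real \<Rightarrow> complex \<Rightarrow> real \<Rightarrow> real \<Rightarrow> complex \<times> real \<Rightarrow> real" where
  "barrier a k c t0 p = ell a k (fst p) - c * (snd p - t0)\<^sup>2"

text \<open>Gradient for the product metric, whence the inverse conformal factor. At a critical
  point of the restricted barrier it is normal to the surface.\<close>

definition barrier_grad :: "real \<Rightarrow> complex \<Rightarrow> real \<Rightarrow> real \<Rightarrow> complex \<times> real \<Rightarrow> complex \<times> real" where
  "barrier_grad a k c t0 p =
     (((1 - (norm (fst p))\<^sup>2)\<^sup>2 / 4) *\<^sub>R dell a k (fst p), - 2 * c * (snd p - t0))"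

lemma H2R_metric_barrier_grad:
  assumes "fst p \<in> H2"
  shows "H2R_metric p (barrier_grad a k c t0 p) v = dell a k (fst p) \<bullet> fst v - 2 * c * (snd p - t0) * snd v"
  using H2_pos[OF assms] by (simp add: H2R_metric_def H2_metric_def barrier_grad_def)

text \<open>First and second derivative tests along the parameter line through \<open>u\<close> in
  direction \<open>v\<close>. The Hessian of \<open>ell\<close> sees only the horizontal metric,
  which is the full metric minus the square of the vertical part; this turns the coefficient
  \<open>2 * c\<close> into \<open>ell + 2 * c\<close>.\<close>

lemma barrier_local_max:
  fixes X :: "real^2 \<Rightarrow> complex \<times> real"
  assumes B: "open B" "u \<in> B" and X: "\<And>x. x \<in> B \<Longrightarrow> X differentiable (at x)"
    and X2: "\<And>w. (\<lambda>x. dparam X x w) differentiable (at u)"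
    and H2: "\<And>x. x \<in> B \<Longrightarrow> fst (X x) \<in> H2"
    and max: "\<And>x. x \<in> B \<Longrightarrow> barrier a k c t0 (X x) \<le> barrier a k c t0 (X u)"
  defines "N \<equiv> barrier_grad a k c t0 (X u)" and "g \<equiv> H2R_metric (X u)"
  shows "g N (dparam X u v) = 0"
    and "ell a k (fst (X u)) * g (dparam X u v) (dparam X u v)
      - (ell a k (fst (X u)) + 2 * c) * (snd (dparam X u v))\<^sup>2
      + g N (cov_dparam H2R_metric X u v v) \<le> 0"
proof -
  obtain e where e: "e > 0" "ball u e \<subseteq> B" using B openE by blast
  \<comment> \<open>The summand \<open>1\<close> covers \<open>v = 0\<close>.\<close>
  define d where "d = e / (norm v + 1)"
  have d: "d > 0" using e by (simp add: d_def add_nonneg_pos)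
  have inB: "u + s *\<^sub>R v \<in> B" if "\<bar>s\<bar> < d" for s
  proof -
    have "\<bar>s\<bar> * norm v \<le> \<bar>s\<bar> * (norm v + 1)" by (simp add: mult_left_mono)
    also have "\<dots> < e" using that by (simp add: d_def pos_less_divide_eq add_nonneg_pos)
    finally show ?thesis using e(2) by (auto simp: dist_norm)
  qed
  define y where "y s = dparam X (u + s *\<^sub>R v) v" for s
  have Xd: "((\<lambda>s. X (u + s *\<^sub>R v)) has_vector_derivative y s) (at s)" if "\<bar>s\<bar> < d" for s
    unfolding y_def by (rule has_vector_derivative_along_line[OF X[OF inB[OF that]]])
  note x1 = bounded_linear.has_vector_derivative[OF bounded_linear_fst Xd]
  have x2: "((\<lambda>s. snd (X (u + s *\<^sub>R v))) has_real_derivative snd (y s)) (at s)" if "\<bar>s\<bar> < d" for s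
    using bounded_linear.has_vector_derivative[OF bounded_linear_snd Xd[OF that]]
    by (simp add: has_real_derivative_iff_has_vector_derivative)
  define A where "A = frechet_derivative (\<lambda>x. dparam X x v) (at u) v"
  have yd: "(y has_vector_derivative A) (at 0)"
    using has_vector_derivative_along_line[of "\<lambda>x. dparam X x v" u 0 v] X2[of v] unfolding y_def
    by (simp add: dparam_def A_def)
  note y1 = bounded_linear.has_vector_derivative[OF bounded_linear_fst yd]
  have y2: "((\<lambda>s. snd (y s)) has_real_derivative snd A) (at 0)"
    using bounded_linear.has_vector_derivative[OF bounded_linear_snd yd]
    by (simp add: has_real_derivative_iff_has_vector_derivative)
  define k1 where "k1 s = dell a k (fst (X (u + s *\<^sub>R v))) \<bullet> fst (y s)
     - 2 * c * (snd (X (u + s *\<^sub>R v)) - t0) * snd (y s)" for s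
  have 1: "((\<lambda>s. barrier a k c t0 (X (u + s *\<^sub>R v))) has_real_derivative k1 s) (at s)"
    if "\<bar>s\<bar> < d" for s
  proof -
    have "((\<lambda>s. c * (snd (X (u + s *\<^sub>R v)) - t0)\<^sup>2) has_real_derivative
       2 * c * (snd (X (u + s *\<^sub>R v)) - t0) * snd (y s)) (at s)"
      by (auto intro!: derivative_eq_intros x2[OF that])
    from DERIV_diff[OF ell_has_derivative[OF x1[OF that] H2[OF inB[OF that]], of a k] this]
    show ?thesis by (simp add: barrier_def k1_def)
  qed
  define p where "p = X u"
  define V where "V = dparam X u v"
  have y0: "y 0 = V" by (simp add: y_def V_def)
  have p: "fst p \<in> H2" using H2 B by (simp add: p_def)
  \<comment> \<open>The second derivative: Hessian of \<open>ell\<close> on the horizontal velocity,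
    \<open>dell\<close> on the horizontal covariant acceleration, and the penalty along the flat
    factor.\<close>
  define k2 where "k2 = (ell a k (fst p) * H2_metric (fst p) (fst V) (fst V)
       + dell a k (fst p) \<bullet> (fst A + H2_gamma (fst p) (fst V) (fst V)))
       - 2 * c * ((snd V)\<^sup>2 + (snd p - t0) * snd A)"
  have 2: "(k1 has_real_derivative k2) (at 0)"
  proof -
    have 3: "((\<lambda>s. 2 * c * ((snd (X (u + s *\<^sub>R v)) - t0) * snd (y s))) has_real_derivative
        2 * c * ((snd V)\<^sup>2 + (snd p - t0) * snd A)) (at 0)"
      using DERIV_cmult[OF DERIV_mult[OF DERIV_diff[OF x2[of 0] DERIV_const[of t0]] y2], of "2 * c"] d
      by (simp add: y0 power2_eq_square p_def algebra_simps)
    from DERIV_diff[OF dell_has_derivative[OF x1[of 0] y1, of a k] 3] p d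
    show ?thesis by (simp add: k1_def[abs_def] k2_def y0 p_def mult.assoc)
  qed
  have "k1 0 = 0" "k2 \<le> 0"
    using DERIV_second_local_max[OF d 1 2] max[OF inB] by auto
  note * = this
  note grad = H2R_metric_barrier_grad[OF p, of a k c t0, folded N_def[folded p_def] g_def[folded p_def]]
  show "g N (dparam X u v) = 0" 
    using *(1) unfolding grad V_def[symmetric] by (simp add: k1_def y0 p_def)
  have cov: "cov_dparam H2R_metric X u v v = A + (H2_gamma (fst p) (fst V) (fst V), 0)"
    unfolding cov_dparam_def A_def V_def p_def using christoffel_H2R p by (simp add: p_def)
  have gV: "g V V = H2_metric (fst p) (fst V) (fst V) + (snd V)\<^sup>2"
    by (simp add: g_def H2R_metric_def p_def power2_eq_square)
  show "ell a k (fst (X u)) * g (dparam X u v) (dparam X u v)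
      - (ell a k (fst (X u)) + 2 * c) * (snd (dparam X u v))\<^sup>2
      + g N (cov_dparam H2R_metric X u v v) \<le> 0"
    using *(2) unfolding grad cov p_def[symmetric] V_def[symmetric] gV k2_def
    by (simp add: algebra_simps)
qed

text \<open>The Hessian inequality is traced over the tangent plane, with everything multiplied by
  the determinant of the first form. The metric term contributes \<open>2 * l\<close>, the vertical
  term at least \<open>- (l + 2 * c)\<close>, and by the translator equation the normal term is the
  vertical part of the gradient \<open>N\<close>, which is at least \<open>- 2 * c\<close> in the
  slab. The sum is at least \<open>l - 4 * c\<close>.\<close>

lemma translator_interior_max:
  assumes tr: "translator S \<A> F" and s: "s \<in> topspace S" and V: "open V" "F s \<in> V"
    and max: "\<And>s'. s' \<in> topspace S \<Longrightarrow> F s' \<in> V \<Longrightarrow> barrier a k c t0 (F s') \<le> barrier a k c t0 (F s)"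
    and c: "c > 0" and t: "\<bar>snd (F s) - t0\<bar> \<le> 1" and k: "a\<^sup>2 < (norm k)\<^sup>2"
  shows "ell a k (fst (F s)) \<le> 4 * c"
proof -
  have S: "smooth_surface S \<A>" and im: "immersion H2R S \<A> F"
    and H: "\<And>W \<psi> u N. (W,\<psi>) \<in> \<A> \<Longrightarrow> u \<in> W \<Longrightarrow> unit_normal H2R_metric (F \<circ> \<psi>) u N \<Longrightarrow>
        mean_curvature H2R_metric (F \<circ> \<psi>) u N = H2R_metric (F (\<psi> u)) N vertical_field"
    using tr unfolding translator_def by fast+
  have "s \<in> (\<Union>(W,\<psi>)\<in>\<A>. \<psi> ` W)" using S s unfolding smooth_surface_def by simp
  then obtain W \<psi> u where A: "(W,\<psi>) \<in> \<A>" "u \<in> W" "s = \<psi> u"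
    by auto
  have W: "open W" "\<psi> ` W \<subseteq> topspace S"
    using S A(1) unfolding smooth_surface_def by (auto dest!: bspec openin_subset)
  define X where "X = F \<circ> \<psi>"
  have sm: "smooth_on W X" and inj: "\<And>u. u \<in> W \<Longrightarrow> inj (dparam X u)"
    using im A(1) unfolding immersion_def X_def dparam_def[abs_def] by fast+
  have FH: "F ` topspace S \<subseteq> H2R" using im unfolding immersion_def by blast
  have "Ck_on (Suc (Suc 0)) W X" using sm unfolding smooth_on_def by blast
  then have X: "X differentiable (at x)" and X2: "(\<lambda>x. dparam X x w) differentiable (at x)" if "x \<in> W" for x w
    using that by (auto simp: dparam_def)
  have XH: "fst (X x) \<in> H2" if "x \<in> W" for x
    using FH W(2) that by (auto simp: X_def H2R_iff[symmetric] image_subset_iff)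
  have "continuous_on W X"
    using X by (meson differentiable_imp_continuous_within continuous_at_imp_continuous_on)
  then have B: "open (W \<inter> X -` V)" using W(1) V(1) by (simp add: continuous_open_preimage)
  have uB: "u \<in> W \<inter> X -` V" using A V by (simp add: X_def)
  define p where "p = X u"
  have pF: "p = F s" by (simp add: p_def X_def A)
  have p: "fst p \<in> H2" using XH A by (simp add: p_def)
  define l where "l = ell a k (fst p)"
  define g where "g = H2R_metric p"
  define N where "N = barrier_grad a k c t0 p"
  define D where "D = dparam X u"
  define Q where "Q = cov_dparam H2R_metric X u"
  have maxX: "barrier a k c t0 (X x) \<le> barrier a k c t0 (X u)" if "x \<in> W \<inter> X -` V" for x
    using max[of "\<psi> x"] that W(2) A by (auto simp: X_def)
  have DN: "g N (D v) = 0" and hess: "l * g (D v) (D v) - (l + 2 * c) * (snd (D v))\<^sup>2 + g N (Q v v) \<le> 0" for v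
    using barrier_local_max[OF B uB X X2[OF A(2)] XH maxX, of v]
    unfolding p_def[symmetric] l_def g_def N_def D_def Q_def by auto
  define e1 e2 :: "real^2" where "e1 = axis 1 1" and "e2 = axis 2 1"
  define g11 g12 g22 where "g11 = g (D e1) (D e1)" and "g12 = g (D e1) (D e2)" and "g22 = g (D e2) (D e2)"
  have linD: "linear D" unfolding D_def by (rule dparam_linear[OF X[OF A(2)]])
  have inj_D: "inj D" using inj A(2) by (simp add: D_def)
  have e2: "e2 \<noteq> 0" and e12: "e1 \<noteq> r *\<^sub>R e2" for r
    by (auto simp: e1_def e2_def vec_eq_iff axis_def intro!: exI[of _ 1])
  have De2: "D e2 \<noteq> 0" using inj_eq[OF inj_D, of e2 0] linear_0[OF linD] e2 by simp
  have "D e1 \<noteq> r *\<^sub>R D e2" for r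
    using e12[of r] inj_eq[OF inj_D, of e1 "r *\<^sub>R e2"] linear_scale[OF linD, of r e2] by simp
  then have det: "g11 * g22 - g12\<^sup>2 > 0"
    unfolding g11_def g12_def g22_def g_def by (rule H2R_metric_Gram_pos[OF p _ De2])
  have g22: "g22 > 0" unfolding g22_def g_def by (rule H2R_metric_pos[OF p De2])
  define n11 n12 n21 n22 where "n11 = g N (Q e1 e1)" and "n12 = g N (Q e1 e2)" 
    and "n21 = g N (Q e2 e1)" and "n22 = g N (Q e2 e2)"
  define t1 t2 where "t1 = snd (D e1)" and "t2 = snd (D e2)"
  have sum: "(g22 * (l * g11 - (l + 2 * c) * t1\<^sup>2 + n11)
      - g12 * (2 * (l * g12 - (l + 2 * c) * (t1 * t2)) + n12 + n21)
      + g11 * (l * g22 - (l + 2 * c) * t2\<^sup>2 + n22)) \<le> 0"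
  proof -
    \<comment> \<open>\<open>w\<close> is orthogonal to \<open>e2\<close>; \<open>g22\<close> times the left hand side is the Hessian at \<open>w\<close> plus
      the Gram determinant times the Hessian at \<open>e2\<close>.\<close>
    define w where "w = g22 *\<^sub>R e1 + (- g12) *\<^sub>R e2"
    have Dw: "D w = g22 *\<^sub>R D e1 + (- g12) *\<^sub>R D e2"
      by (simp only: w_def linear_add[OF linD] linear_scale[OF linD])
    note cb = cov_dparam_bilinear[OF W(1) A(2) X X2[OF A(2)] p[unfolded p_def], folded Q_def]
    have Qw: "Q w w = g22 *\<^sub>R (g22 *\<^sub>R Q e1 e1 + (- g12) *\<^sub>R Q e2 e1)
       + (- g12) *\<^sub>R (g22 *\<^sub>R Q e1 e2 + (- g12) *\<^sub>R Q e2 e2)"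
      by (simp only: w_def cb)
    have 1: "g (D w) (D w) = g22 * (g22 * g11 - g12 * g12) - g12 * (g22 * g12 - g12 * g22)"
      unfolding Dw g_def H2R_metric_simps
      by (simp add: g11_def g12_def g22_def g_def H2R_metric_commute[of p "D e2" "D e1"])
    have 2: "snd (D w) = g22 * t1 - g12 * t2" by (simp add: Dw t1_def t2_def)
    have 3: "g N (Q w w) = g22 * (g22 * n11 - g12 * n21) - g12 * (g22 * n12 - g12 * n22)"
      unfolding Qw g_def H2R_metric_simps by (simp add: n11_def n12_def n21_def n22_def g_def)
    have "l * g (D w) (D w) - (l + 2 * c) * (snd (D w))\<^sup>2 + g N (Q w w)
       + (g11 * g22 - g12\<^sup>2) * (l * g22 - (l + 2 * c) * t2\<^sup>2 + n22) \<le> 0"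
      using hess[of w] mult_nonneg_nonpos[OF less_imp_le[OF det] hess[of e2, folded g22_def t2_def n22_def]]
      by linarith
    also have "l * g (D w) (D w) - (l + 2 * c) * (snd (D w))\<^sup>2 + g N (Q w w)
       + (g11 * g22 - g12\<^sup>2) * (l * g22 - (l + 2 * c) * t2\<^sup>2 + n22)
      = g22 * (g22 * (l * g11 - (l + 2 * c) * t1\<^sup>2 + n11)
      - g12 * (2 * (l * g12 - (l + 2 * c) * (t1 * t2)) + n12 + n21)
      + g11 * (l * g22 - (l + 2 * c) * t2\<^sup>2 + n22))"
      unfolding 1 2 3 by (simp add: power2_eq_square algebra_simps)
    finally show ?thesis using g22 by (simp add: mult_le_0_iff)
  qed
  have vert: "g22 * t1\<^sup>2 - 2 * g12 * (t1 * t2) + g11 * t2\<^sup>2 \<le> g11 * g22 - g12\<^sup>2"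
    using H2R_metric_vertical_le[of p "D e2" "D e1"] unfolding g11_def g12_def g22_def g_def t1_def t2_def .
  \<comment> \<open>The translator equation is linear in the normal, so it passes from a unit normal
    to the gradient \<open>N\<close>.\<close>
  have mc: "g22 * n11 - g12 * (n12 + n21) + g11 * n22 = (g11 * g22 - g12\<^sup>2) * (- 2 * c * (snd p - t0))"
  proof -
    \<comment> \<open>Spacelikeness of the functional excludes a vanishing gradient, so
      \<open>N\<close> can be normalized.\<close>
    have "N \<noteq> 0"
      using dell_nonzero[OF k p] H2_pos[OF p] by (auto simp: N_def barrier_grad_def prod_eq_iff)
    then have gN: "g N N > 0" unfolding g_def by (rule H2R_metric_pos[OF p])
    define r where "r = sqrt (g N N)"
    have r: "r > 0" "r * r = g N N" using gN by (auto simp: r_def)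
    define M where "M = (1/r) *\<^sub>R N"
    have NM: "N = r *\<^sub>R M" using r by (simp add: M_def)
    have gMM: "g M M = 1" unfolding M_def g_def H2R_metric_simps using r gN by (simp add: g_def[symmetric] field_simps)
    have "unit_normal H2R_metric X u M"
      unfolding unit_normal_def p_def[symmetric] g_def[symmetric] D_def[symmetric]
      using gMM DN by (auto simp: M_def g_def H2R_metric_simps)
    from H[OF A(1,2) this[unfolded X_def], folded X_def] 
    have mcM: "mean_curvature H2R_metric X u M = snd M"
      by (simp add: vertical_field_def H2R_metric_def H2_metric_def)
    define I J where "I = first_form H2R_metric X u" and "J = second_form H2R_metric X u M"
    have I: "I$1$1 = g11" "I$1$2 = g12" "I$2$1 = g12" "I$2$2 = g22"
      unfolding I_def first_form_def g11_def g12_def g22_def e1_def e2_def D_def g_def p_def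
      by (simp_all add: H2R_metric_commute[of "X u" "dparam X u (axis 2 1)" "dparam X u (axis 1 1)"])
    have rM: "H2R_metric (X u) (r *\<^sub>R M) w = r * H2R_metric (X u) w M" for w
      by (simp only: H2R_metric_simps H2R_metric_commute[of "X u" w])
    have J: "r * J$1$1 = n11" "r * J$1$2 = n12" "r * J$2$1 = n21" "r * J$2$2 = n22"
      unfolding J_def second_form_def n11_def n12_def n21_def n22_def e1_def e2_def Q_def g_def NM p_def
      by (simp_all add: rM)
    have "snd M * (g11 * g22 - g12 * g12) = g22 * J$1$1 - g12 * J$2$1 - g12 * J$1$2 + g11 * J$2$2"
      using trace_matrix_inv_2[of I J] det mcM
      unfolding mean_curvature_def I_def[symmetric] J_def[symmetric] I by (simp add: power2_eq_square)
    from arg_cong[OF this, of "\<lambda>x. r * x"]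
    have "snd N * (g11 * g22 - g12 * g12) = g22 * n11 - g12 * n21 - g12 * n12 + g11 * n22"
      by (simp add: NM J[symmetric] algebra_simps)
    moreover have "snd N = - 2 * c * (snd p - t0)" by (simp add: N_def barrier_grad_def)
    ultimately show ?thesis by (simp add: power2_eq_square algebra_simps)
  qed
  show ?thesis
  proof (rule ccontr)
    assume "\<not> ?thesis"
    \<comment> \<open>In particular \<open>l + 2 * c\<close> is nonnegative, as the use of
      \<open>vert\<close> requires.\<close>
    then have l: "l > 4 * c" by (simp add: l_def pF)
    let ?d = "g11 * g22 - g12\<^sup>2" and ?v = "g22 * t1\<^sup>2 - 2 * g12 * (t1 * t2) + g11 * t2\<^sup>2"
    have "2 * l * ?d - (l + 2 * c) * ?v + ?d * (- 2 * c * (snd p - t0)) \<le> 0"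
      using sum mc by (simp add: power2_eq_square algebra_simps)
    moreover have "(l + 2 * c) * ?v \<le> (l + 2 * c) * ?d" using vert l c by (intro mult_left_mono) auto
    moreover have "- 2 * c * (snd p - t0) \<ge> - 2 * c" using t c pF by (simp add: abs_le_iff)
    then have "?d * (- 2 * c * (snd p - t0)) \<ge> ?d * (- 2 * c)" using det by (intro mult_left_mono) auto
    moreover have "?d * (l - 4 * c) > 0" using det l by simp
    ultimately show False by (simp add: algebra_simps)
  qed
qed

section \<open>The surface near its boundary at infinity\<close>

lemma openin_surface_at_infinity:
  assumes "open V"
  shows "openin (surface_at_infinity S F \<alpha>) {x \<in> topspace S <+> \<alpha>. case_sum (H2R_embed \<circ> F) id x \<in> V}"
  unfolding surface_at_infinity_def using assms by (intro topology_generated_by_Basis) blast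

lemma topspace_surface_at_infinity: "topspace (surface_at_infinity S F \<alpha>) = topspace S <+> \<alpha>"
proof
  show "topspace S <+> \<alpha> \<subseteq> topspace (surface_at_infinity S F \<alpha>)"
    using openin_subset[OF openin_surface_at_infinity[OF open_UNIV, of S F \<alpha>]] by simp
  show "topspace (surface_at_infinity S F \<alpha>) \<subseteq> topspace S <+> \<alpha>"
    unfolding surface_at_infinity_def topology_generated_by_topspace by (auto dest: openin_subset)
qed

lemma continuous_map_surface_at_infinity:
  "continuous_map (surface_at_infinity S F \<alpha>) euclidean (case_sum (H2R_embed \<circ> F) id)"
  using openin_surface_at_infinity by (auto simp: continuous_map_def topspace_surface_at_infinity)

lemma half_plane_chartE:
  assumes "half_plane_chart T U \<phi>"
  obtains \<psi> where "openin T U" "openin (top_of_set half_plane) (\<phi> ` U)"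
    "continuous_map (subtopology T U) (top_of_set (\<phi> ` U)) \<phi>"
    "continuous_map (top_of_set (\<phi> ` U)) (subtopology T U) \<psi>"
    "\<And>x. x \<in> U \<Longrightarrow> \<psi> (\<phi> x) = x" "\<And>y. y \<in> \<phi> ` U \<Longrightarrow> \<phi> (\<psi> y) = y" "\<And>y. y \<in> \<phi> ` U \<Longrightarrow> \<psi> y \<in> U"
proof -
  have U: "openin T U" "openin (top_of_set half_plane) (\<phi> ` U)"
    and h: "homeomorphic_map (subtopology T U) (top_of_set (\<phi> ` U)) \<phi>"
    using assms by (auto simp: half_plane_chart_def)
  obtain \<psi> where "homeomorphic_maps (subtopology T U) (top_of_set (\<phi> ` U)) \<phi> \<psi>"
    using h homeomorphic_map_maps by blast
  then have c: "continuous_map (subtopology T U) (top_of_set (\<phi> ` U)) \<phi>"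
      "continuous_map (top_of_set (\<phi> ` U)) (subtopology T U) \<psi>"
    and i: "\<forall>x\<in>topspace (subtopology T U). \<psi> (\<phi> x) = x" "\<forall>y\<in>\<phi> ` U. \<phi> (\<psi> y) = y"
    by (auto simp: homeomorphic_maps_def)
  have TU: "topspace (subtopology T U) = U"
    using openin_subset[OF U(1)] by (simp add: topspace_subtopology Int_absorb1)
  have "\<psi> ` \<phi> ` U \<subseteq> U"
    using continuous_map_image_subset_topspace[OF c(2)] by (simp only: TU topspace_euclidean_subtopology)
  with i[unfolded TU] show thesis
    by (intro that[OF U c]) blast+
qed

text \<open>Invariance of domain: otherwise the transition to a chart having the point on its edge would map
  an open subset of the plane onto a set that is not open.\<close>

lemma chart_interior_not_boundary:
  assumes ch: "half_plane_chart T U \<phi>" and x: "x \<in> U" "\<phi> x $ 2 > 0"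
  shows "x \<notin> surface_boundary T"
proof
  assume "x \<in> surface_boundary T"
  then obtain U' \<phi>' where ch': "half_plane_chart T U' \<phi>'" and x': "x \<in> U'" "\<phi>' x $ 2 = 0"
    unfolding surface_boundary_def by blast
  obtain \<psi> where U: "openin T U" "openin (top_of_set half_plane) (\<phi> ` U)"
    and \<psi>: "continuous_map (top_of_set (\<phi> ` U)) (subtopology T U) \<psi>"
    "\<And>x. x \<in> U \<Longrightarrow> \<psi> (\<phi> x) = x" "\<And>y. y \<in> \<phi> ` U \<Longrightarrow> \<phi> (\<psi> y) = y" "\<And>y. y \<in> \<phi> ` U \<Longrightarrow> \<psi> y \<in> U"
    using half_plane_chartE[OF ch] by metis
  obtain \<psi>' where U': "openin T U'" "openin (top_of_set half_plane) (\<phi>' ` U')"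
    and \<phi>': "continuous_map (subtopology T U') (top_of_set (\<phi>' ` U')) \<phi>'"
    and \<psi>': "\<And>x. x \<in> U' \<Longrightarrow> \<psi>' (\<phi>' x) = x"
    using half_plane_chartE[OF ch'] by metis
  \<comment> \<open>The strict inequality makes \<open>W\<close> open in the plane and not merely in
    the half plane.\<close>
  define W where "W = {y \<in> \<phi> ` U. \<psi> y \<in> U'} \<inter> {v. v $ 2 > 0}"
  have "openin (subtopology T U) (U \<inter> U')"
    using U U' by (metis inf_commute openin_subtopology_Int)
  from openin_continuous_map_preimage[OF \<psi>(1) this]
  have "openin (top_of_set (\<phi> ` U)) {y \<in> \<phi> ` U. \<psi> y \<in> U'}"
    using \<psi>(4) by (simp add: Collect_conj_eq[symmetric] cong: conj_cong)
  then have "openin (top_of_set half_plane) {y \<in> \<phi> ` U. \<psi> y \<in> U'}"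
    using U(2) openin_trans by blast
  then obtain Y where Y: "open Y" "{y \<in> \<phi> ` U. \<psi> y \<in> U'} = half_plane \<inter> Y"
    by (auto simp: openin_open)
  then have "W = Y \<inter> {v. v $ 2 > 0}" by (auto simp: W_def half_plane_def)
  then have oW: "open W" using Y(1) by (auto intro!: open_Int open_halfspace_component_gt_cart)
  have cont: "continuous_on W (\<phi>' \<circ> \<psi>)"
  proof -
    have "continuous_map (top_of_set W) (subtopology T U') \<psi>"
    proof -
      have "continuous_map (top_of_set W) T \<psi>"
        using continuous_map_from_subtopology_mono[of "euclidean" "\<phi> ` U" T \<psi> W] \<psi>(1)
        by (auto simp: continuous_map_in_subtopology W_def)
      then show ?thesis by (auto simp: continuous_map_in_subtopology W_def)
    qed
    from continuous_map_compose[OF this \<phi>']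
    show ?thesis by (auto simp: continuous_map_in_subtopology)
  qed
  have inj: "inj_on (\<phi>' \<circ> \<psi>) W"
    by (rule inj_on_inverseI[where g = "\<phi> \<circ> \<psi>'"]) (auto simp: W_def \<psi>' \<psi>)
  have "open ((\<phi>' \<circ> \<psi>) ` W)" using invariance_of_domain[OF cont oW inj] .
  moreover have "\<phi>' x \<in> (\<phi>' \<circ> \<psi>) ` W"
    using x x' \<psi> by (intro image_eqI[where x = "\<phi> x"]) (auto simp: W_def)
  ultimately obtain e where e: "e > 0" "ball (\<phi>' x) e \<subseteq> (\<phi>' \<circ> \<psi>) ` W"
    using openE by blast
  \<comment> \<open>A point below the edge: it lies in the open image but outside the half
    plane.\<close>
  have "\<phi>' x - (e/2) *\<^sub>R axis 2 1 \<in> ball (\<phi>' x) e" using e by (simp add: dist_norm norm_axis_1)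
  moreover have "(\<phi>' \<circ> \<psi>) ` W \<subseteq> \<phi>' ` U'" by (auto simp: W_def)
  ultimately have "\<phi>' x - (e/2) *\<^sub>R axis 2 1 \<in> \<phi>' ` U'" using e by blast
  then have "\<phi>' x - (e/2) *\<^sub>R axis 2 1 \<in> half_plane" using openin_subset[OF U'(2)] by auto
  then show False using x' e by (simp add: half_plane_def)
qed

text \<open>In a half plane chart at the boundary point, a short segment leads straight into the
  surface. Its heights start at \<sigma> and become finite, so by connectedness they take every
  value beyond the final one, while the horizontal position stays in \<open>N\<close>. The factor
  \<open>sg\<close> treats both ends of the line at once.\<close>

lemma surface_reaches_heights:
  assumes cs: "continuous_surface_with_boundary S F \<alpha>"
    and sg: "sg \<in> {1, -1::real}" and \<sigma>: "\<sigma> = ereal sg * \<infinity>"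
    and p: "(p, \<sigma>) \<in> \<alpha>" and N: "open N" "p \<in> N"
  obtains h0 where "\<And>h. h > h0 \<Longrightarrow> \<exists>s \<in> topspace S. fst (F s) \<in> N \<and> snd (F s) = sg * h"
proof -
  define T where "T = surface_at_infinity S F \<alpha>"
  have bd: "surface_boundary T = Inr ` \<alpha>"
    using cs by (simp add: continuous_surface_with_boundary_def T_def)
  then have "Inr (p,\<sigma>) \<in> surface_boundary T" using p by simp
  then obtain U \<phi> where ch: "half_plane_chart T U \<phi>" and pU: "Inr (p,\<sigma>) \<in> U" "\<phi> (Inr (p,\<sigma>)) $ 2 = 0"
    unfolding surface_boundary_def by blast
  obtain \<psi> where U: "openin T U" "openin (top_of_set half_plane) (\<phi> ` U)"
    and \<psi>: "continuous_map (top_of_set (\<phi> ` U)) (subtopology T U) \<psi>"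
    "\<And>x. x \<in> U \<Longrightarrow> \<psi> (\<phi> x) = x" "\<And>y. y \<in> \<phi> ` U \<Longrightarrow> \<phi> (\<psi> y) = y" "\<And>y. y \<in> \<phi> ` U \<Longrightarrow> \<psi> y \<in> U"
    using half_plane_chartE[OF ch] by metis
  define q where "q = \<phi> (Inr (p,\<sigma>))"
  have q: "q \<in> \<phi> ` U" "q $ 2 = 0" "\<psi> q = Inr (p,\<sigma>)" using pU \<psi> by (auto simp: q_def)
  obtain Y where Y: "open Y" "\<phi> ` U = half_plane \<inter> Y" using U(2) by (auto simp: openin_open)
  then obtain e where e: "e > 0" "ball q e \<subseteq> Y" using q openE by blast
  define y where "y s = q + s *\<^sub>R (axis 2 1 :: real^2)" for s
  have yU: "y s \<in> \<phi> ` U" if "0 \<le> s" "s < e" for s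
    using that e q Y by (auto simp: y_def half_plane_def dist_norm norm_axis_1)
  define P where "P = case_sum (H2R_embed \<circ> F) id \<circ> \<psi> \<circ> y"
  have "continuous_map (top_of_set {0..<e}) (top_of_set (\<phi> ` U)) y"
    using yU by (auto simp: continuous_map_in_subtopology y_def intro!: continuous_intros)
  from continuous_map_compose[OF this \<psi>(1)]
  have "continuous_map (top_of_set {0..<e}) T (\<psi> \<circ> y)" by (simp add: continuous_map_in_subtopology)
  from continuous_map_compose[OF this continuous_map_surface_at_infinity[of S F \<alpha>, folded T_def]]
  have P: "continuous_on {0..<e} P" by (simp add: P_def o_assoc)
  have P0: "P 0 = (p, \<sigma>)" by (simp add: P_def y_def q)
  have PF: "\<exists>x \<in> topspace S. P s = (fst (F x), ereal (snd (F x)))" if "0 < s" "s < e" for s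
  proof -
    have "\<psi> (y s) \<in> U" using \<psi> yU that by auto
    moreover have "\<phi> (\<psi> (y s)) $ 2 > 0" using \<psi>(3)[OF yU] that q by (simp add: y_def)
    \<comment> \<open>A positive second coordinate makes the point interior, so it belongs to the
      surface itself.\<close>
    ultimately have "\<psi> (y s) \<notin> Inr ` \<alpha>" using chart_interior_not_boundary[OF ch] bd by blast
    moreover have "\<psi> (y s) \<in> topspace S <+> \<alpha>"
      using \<open>\<psi> (y s) \<in> U\<close> openin_subset[OF U(1)] by (auto simp: T_def topspace_surface_at_infinity)
    ultimately show ?thesis by (auto simp: P_def H2R_embed_def)
  qed
  have "continuous_on {0..<e} (fst \<circ> P)" unfolding o_def by (intro continuous_on_fst P)
  then have "openin (top_of_set {0..<e}) ({0..<e} \<inter> (fst \<circ> P) -` N)"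
    using N(1) continuous_openin_preimage_gen by blast
  moreover have "0 \<in> {0..<e} \<inter> (fst \<circ> P) -` N" using e N P0 by simp
  ultimately obtain d where d: "d > 0" "\<And>s. s \<in> {0..<e} \<Longrightarrow> dist s 0 < d \<Longrightarrow> fst (P s) \<in> N"
    unfolding openin_euclidean_subtopology_iff by (metis IntE vimageE comp_apply)
  define r where "r = min (d/2) (e/2)"
  have r: "0 < r" "r < d" "r < e" using d e by (auto simp: r_def)
  obtain x where x: "P r = (fst (F x), ereal (snd (F x)))" using PF r by blast
  have con: "connected ((snd \<circ> P) ` {0..r})"
    unfolding o_def using r
    by (intro connected_continuous_image continuous_on_snd continuous_on_subset[OF P]) auto
  have mem: "\<sigma> \<in> (snd \<circ> P) ` {0..r}" "ereal (snd (F x)) \<in> (snd \<circ> P) ` {0..r}"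
    using P0 x r image_eqI[of \<sigma> "snd \<circ> P" 0] image_eqI[of "ereal (snd (F x))" "snd \<circ> P" r] by auto
  show thesis
  proof (rule that[of "sg * snd (F x)"])
    fix h assume h: "h > sg * snd (F x)"
    have "ereal (sg * h) \<in> (snd \<circ> P) ` {0..r}"
      using sg
    proof (rule insertE)
      assume "sg = 1"
      then show ?thesis using h \<sigma> connectedD_interval[OF con mem(2,1), of "ereal (sg * h)"] by auto
    next
      assume "sg \<in> {-1}"
      then show ?thesis using h \<sigma> connectedD_interval[OF con mem(1,2), of "ereal (sg * h)"] by auto
    qed
    then obtain s where s: "s \<in> {0..r}" "snd (P s) = ereal (sg * h)" by auto
    \<comment> \<open>At \<open>s = 0\<close> the height is infinite.\<close>
    then have "s \<noteq> 0" using P0 \<sigma> sg by auto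
    then obtain z where "z \<in> topspace S" "P s = (fst (F z), ereal (snd (F z)))"
      using PF[of s] s r by auto
    then show "\<exists>s \<in> topspace S. fst (F s) \<in> N \<and> snd (F s) = sg * h"
      using s d(2)[of s] r by (intro bexI[of _ z]) auto
  qed
qed

text \<open>Points of \<open>A\<close> over \<open>C\<close> with unbounded signed height would have
  a subsequence whose projections converge in \<open>C\<close>, and its limit would belong to the
  horizontal boundary.\<close>

lemma no_points_over_compact:
  assumes sg: "sg \<in> {1, -1::real}" and \<sigma>: "\<sigma> = ereal sg * \<infinity>"
    and C: "compact C" "C \<subseteq> H2" and dis: "\<And>x. x \<in> C \<Longrightarrow> (x, \<sigma>) \<notin> horizontal_boundary \<sigma> A"
  obtains h0 where "\<And>p. p \<in> A \<Longrightarrow> fst p \<in> C \<Longrightarrow> sg * snd p \<le> h0"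
proof (rule ccontr)
  assume "\<not> thesis"
  then have "\<exists>p. p \<in> A \<and> fst p \<in> C \<and> sg * snd p > real n" for n
    using that[of "real n"] by (meson not_le)
  then obtain p where p: "\<And>n. p n \<in> A" "\<And>n. fst (p n) \<in> C" "\<And>n. sg * snd (p n) > real n"
    by metis
  obtain x r where x: "x \<in> C" "strict_mono r" "(\<lambda>n. fst (p (r n))) \<longlonglongrightarrow> x"
    using C(1) p(2) unfolding compact_def by (force simp: o_def)
  have "filterlim (\<lambda>n. sg * snd (p (r n))) at_top sequentially"
  proof (rule filterlim_at_top_mono[OF filterlim_real_sequentially])
    have "real n \<le> sg * snd (p (r n))" for n
      using p(3)[of "r n"] seq_suble[OF x(2), of n] by linarith
    then show "\<forall>\<^sub>F n in sequentially. real n \<le> sg * snd (p (r n))" by simp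
  qed
  \<comment> \<open>Multiplying by \<open>sg\<close> a second time restores the height itself, as
    \<open>sg\<close> squares to \<open>1\<close>.\<close>
  then have "(\<lambda>n. ereal sg * ereal (sg * snd (p (r n)))) \<longlonglongrightarrow> ereal sg * \<infinity>"
    using sg by (intro tendsto_cmult_ereal) (auto simp: tendsto_PInfty_eq_at_top)
  moreover have "ereal sg * ereal (sg * snd (p (r n))) = ereal (snd (p (r n)))" for n
    using sg by auto
  ultimately have "(\<lambda>n. ereal (snd (p (r n)))) \<longlonglongrightarrow> \<sigma>" by (simp only: \<sigma>)
  from tendsto_Pair[OF x(3) this]
  have "(\<lambda>n. H2R_embed (p (r n))) \<longlonglongrightarrow> (x, \<sigma>)" by (simp add: H2R_embed_def)
  moreover have "x \<in> H2" using x C by auto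
  moreover have "\<sigma> \<in> {\<infinity>, -\<infinity>}" using sg \<sigma> by auto
  ultimately have "(x, \<sigma>) \<in> horizontal_boundary \<sigma> A"
    using p(1) unfolding horizontal_boundary_def asymptotic_boundary_def H2R_infinity_def
    by (auto intro!: exI[of _ "\<lambda>n. p (r n)"])
  then show False using dis x(1) by blast
qed

section \<open>Convexity of the boundary arc\<close>

text \<open>Since the functional vanishes at both end points, a positive maximum is attained
  strictly between them. Near the maximum points the closure hypothesis keeps away the rest of the
  horizontal boundary, and properness of the arc keeps away its own tails; the horizontal boundary
  there lies on the subarc.\<close>

lemma arc_below:
  fixes S :: "'a topology" and \<A> :: "'a parametrizations" and I :: "real set"
  assumes tr: "translator S \<A> F" and pr: "proper_map S (top_of_set H2R) F"
    and sg: "sg \<in> {1, -1::real}" and \<sigma>: "\<sigma> = ereal sg * \<infinity>"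
    and cl: "closure (horizontal_boundary \<sigma> (F ` topspace S) - \<alpha>) \<inter> \<alpha> = {}"
    and cs: "continuous_surface_with_boundary S F \<alpha>"
    and I: "is_interval I" and c: "continuous_map (top_of_set I) (top_of_set (H2 \<times> {\<sigma>})) c"
    "proper_map (top_of_set I) (top_of_set (H2 \<times> {\<sigma>})) c" "inj_on c I" and \<alpha>: "\<alpha> = c ` I"
    and ij: "i \<in> I" "j \<in> I" and zero: "ell a k (fst (c i)) = 0" "ell a k (fst (c j)) = 0"
    and k: "a\<^sup>2 < (norm k)\<^sup>2" and t: "t \<in> {i..j}"
  shows "ell a k (fst (c t)) \<le> 0"
proof (rule ccontr)
  assume pos: "\<not> ?thesis"
  define d where "d t = fst (c t)" for t
  have ijI: "{i..j} \<subseteq> I" using mem_is_interval_1_I[OF I ij] by (auto simp only: atLeastAtMost_iff)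
  have cd: "c t = (d t, \<sigma>)" and dH: "d t \<in> H2" if "t \<in> I" for t
  proof -
    have "c t \<in> H2 \<times> {\<sigma>}" using continuous_map_image_subset_topspace[OF c(1)] that by auto
    then show "c t = (d t, \<sigma>)" "d t \<in> H2" by (auto simp: d_def)
  qed
  have "continuous_on I c" using c(1) by (simp add: continuous_map_in_subtopology)
  then have contd: "continuous_on {i..j} d"
    unfolding d_def by (intro continuous_on_fst continuous_on_subset[OF _ ijI])
  have contl: "continuous_on {i..j} (\<lambda>t. ell a k (d t))"
    by (rule continuous_on_compose2[OF continuous_on_ell contd]) (use dH ijI in auto)
  obtain tm where tm: "tm \<in> {i..j}" "\<And>t. t \<in> {i..j} \<Longrightarrow> ell a k (d t) \<le> ell a k (d tm)"
    using continuous_attains_sup[OF compact_Icc _ contl] t by auto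
  define m where "m = ell a k (d tm)"
  have m: "m > 0" using tm(2)[OF t] pos by (simp add: m_def d_def)
  \<comment> \<open>All maximum points of the subarc are taken together: a collar around only one of
    them could meet another, and no value below \<open>m\<close> would bound the functional
    there.\<close>
  define K where "K = d ` {t \<in> {i..j}. ell a k (d t) = m}"
  have "closed {t \<in> {i..j}. ell a k (d t) = m}"
    by (rule continuous_closed_preimage_constant[OF contl]) simp
  then have "compact {t \<in> {i..j}. ell a k (d t) = m}"
    by (metis (no_types, lifting) closed_Int_compact compact_Icc mem_Collect_eq inf.orderE subsetI)
  then have K: "compact K" unfolding K_def
    by (rule compact_continuous_image[OF continuous_on_subset[OF contd], rotated]) auto
  have K0: "d tm \<in> K" using tm(1) by (auto simp: K_def m_def)
  define L where "L = closure (horizontal_boundary \<sigma> (F ` topspace S) - \<alpha>)"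
  \<comment> \<open>A proper map is closed, so the tails of the arc, end points included, have a
    relatively closed image.\<close>
  have "closedin (top_of_set I) (I \<inter> ({..i} \<union> {j..}))"
    by (intro closedin_closed_Int closed_Un closed_atMost closed_atLeast)
  then have "closedin (top_of_set (H2 \<times> {\<sigma>})) (c ` (I \<inter> ({..i} \<union> {j..})))"
    using c(2) by (simp add: proper_map_def closed_map_def)
  then obtain E where E: "closed E" "c ` (I \<inter> ({..i} \<union> {j..})) = H2 \<times> {\<sigma>} \<inter> E"
    unfolding closedin_closed by blast
  define \<Omega> where "\<Omega> = ((\<lambda>x. (x,\<sigma>)) -` (- (E \<union> L))) \<inter> (H2 \<inter> ell a k -` {m/2<..})"
  have openell: "open (H2 \<inter> ell a k -` {r<..})" for r
    by (rule continuous_open_preimage[OF continuous_on_ell]) (auto simp: H2_def)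
  have "open ((\<lambda>x. (x,\<sigma>)) -` (- (E \<union> L)))"
    using E(1) by (intro open_vimage continuous_intros) (auto simp: L_def open_Compl)
  then have \<Omega>: "open \<Omega>" unfolding \<Omega>_def using openell by blast
  \<comment> \<open>Over \<Omega> the only points of the horizontal boundary are those of the
    subarc.\<close>
  have between: "\<exists>t\<in>{i..j}. x = d t" if "x \<in> \<Omega>" "(x,\<sigma>) \<in> horizontal_boundary \<sigma> (F ` topspace S)" for x
  proof -
    have "(x,\<sigma>) \<notin> L" "x \<in> H2" "(x,\<sigma>) \<notin> E" using that(1) by (auto simp: \<Omega>_def)
    then have "(x,\<sigma>) \<in> \<alpha>" using that(2) subsetD[OF closure_subset] unfolding L_def by (metis DiffI)
    then obtain t where t: "t \<in> I" "(x,\<sigma>) = c t" using \<alpha> by auto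
    then have "t \<notin> I \<inter> ({..i} \<union> {j..})" using E \<open>(x,\<sigma>) \<notin> E\<close> by auto
    then show ?thesis using t cd[OF t(1)] by (intro bexI[of _ t]) auto
  qed
  have "K \<subseteq> \<Omega>"
  proof
    fix x assume "x \<in> K"
    then obtain t where t: "t \<in> {i..j}" "x = d t" "ell a k (d t) = m" by (auto simp: K_def)
    then have tI: "t \<in> I" and "t \<noteq> i" "t \<noteq> j" using zero m ijI by (auto simp: d_def)
    \<comment> \<open>Injectivity separates the maximum points from the tails.\<close>
    then have "c t \<notin> c ` (I \<inter> ({..i} \<union> {j..}))" using t c(3) by (auto simp: inj_on_def)
    then have "(x,\<sigma>) \<notin> E" using E dH[OF tI] cd[OF tI] t by auto
    moreover have "(x,\<sigma>) \<in> \<alpha>" unfolding \<alpha> using cd[OF tI] t(2) tI by (metis imageI)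
    then have "(x,\<sigma>) \<notin> L" using cl unfolding L_def by blast
    ultimately show "x \<in> \<Omega>" using t dH[OF tI] m by (auto simp: \<Omega>_def)
  qed
  with K K0 \<Omega> obtain e where e: "e > 0" "{x. infdist x K \<le> e} \<subseteq> \<Omega>"
    by (metis compact_in_open_separated empty_iff)
  define U C where "U = {x. infdist x K < e}" and "C = {x. infdist x K \<le> e}"
  have U: "open U" unfolding U_def by (intro open_Collect_less continuous_intros)
  have C: "compact C" unfolding C_def using K K0 e by (intro compact_infdist_le) auto
  have UC: "U \<subseteq> C" and C\<Omega>: "C \<subseteq> \<Omega>" and KU: "K \<subseteq> U" using e by (auto simp: U_def C_def)
  have CH: "C \<subseteq> H2" using C\<Omega> by (auto simp: \<Omega>_def)
  have contC: "continuous_on C (ell a k)" using continuous_on_subset[OF continuous_on_ell CH] .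
  \<comment> \<open>The part of the subarc in the collar around \<open>U\<close>. It contains no
    maximum point, so compactness gives a bound \<open>m'\<close> strictly below
    \<open>m\<close>.\<close>
  define R where "R = d ` {i..j} \<inter> (C - U)"
  have R: "compact R" unfolding R_def
    by (intro compact_Int compact_continuous_image contd compact_diff C U compact_Icc)
  have Rm: "ell a k x < m" if xR: "x \<in> R" for x
  proof -
    obtain t where "t \<in> {i..j}" "x = d t" "x \<notin> U" using xR by (auto simp: R_def)
    then show ?thesis using tm(2)[of t] KU by (force simp: m_def[symmetric] K_def)
  qed
  obtain m' where m': "m' < m" "\<And>x. x \<in> R \<Longrightarrow> ell a k x \<le> m'"
  proof (cases "R = {}")
    case True
    \<comment> \<open>Without such points any number below \<open>m\<close> serves as bound.\<close>
    then show ?thesis using that[of 0] m by auto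
  next
    case False
    have "continuous_on R (ell a k)" by (rule continuous_on_subset[OF contC]) (auto simp: R_def)
    then obtain x where "x \<in> R" "\<And>y. y \<in> R \<Longrightarrow> ell a k y \<le> ell a k x"
      using continuous_attains_sup[OF R False] by blast
    then show ?thesis using that[of "ell a k x"] Rm by blast
  qed
  \<comment> \<open>The first bound puts \<open>m'\<close> below \<open>m - c0/4\<close>, so the
    maximum avoids the collar; the second makes \<open>4 * c0\<close> at most \<open>m/4\<close>,
    which contradicts a value above \<open>m - c0/4\<close>.\<close>
  define c0 where "c0 = min ((m - m')/2) (m/16)"
  have c0: "c0 > 0" "c0 \<le> m / 16" "c0 \<le> (m - m') / 2"
    using m m'(1) unfolding c0_def by (simp_all only: min.cobounded1 min.cobounded2) simp
  then have m'c: "m' < m - c0 / 4" using m'(1) by (simp add: field_simps)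
  \<comment> \<open>Positions to be avoided at large heights: a functional too far above
    \<open>m\<close> anywhere in \<open>C\<close>, or too close to \<open>m\<close> in the collar.
    The bounds \<open>m\<close> and \<open>m'\<close> on the subarc exclude boundary points over
    this compact set, so the surface over it has bounded signed height.\<close>
  define bad where "bad = (C \<inter> ell a k -` {m + c0/4..}) \<union> ((C - U) \<inter> ell a k -` {m - c0/4..})"
  have "compact (C \<inter> ell a k -` {r..})" for r
    using continuous_closed_preimage[OF contC compact_imp_closed[OF C] closed_atLeast, of r] C
    by (metis compact_Int_closed inf.left_idem)
  moreover have "compact ((C - U) \<inter> ell a k -` {r..})" for r
    using \<open>compact (C \<inter> ell a k -` {r..})\<close> compact_diff[OF _ U] by (metis Int_Diff Int_commute)
  ultimately have bad: "compact bad" unfolding bad_def by blast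
  have "(x,\<sigma>) \<notin> horizontal_boundary \<sigma> (F ` topspace S)" if "x \<in> bad" for x
  proof
    assume "(x,\<sigma>) \<in> horizontal_boundary \<sigma> (F ` topspace S)"
    moreover have "x \<in> \<Omega>" using that C\<Omega> by (auto simp: bad_def)
    ultimately obtain t where t: "t \<in> {i..j}" "x = d t" using between by blast
    then have "ell a k x \<le> m" using tm(2) by (simp add: m_def)
    moreover have "ell a k x \<le> m'" if "x \<in> C - U" using that t m'(2) by (auto simp: R_def)
    ultimately show False using that c0 m'c by (auto simp: bad_def)
  qed
  then obtain h0 where h0: "\<And>p. p \<in> F ` topspace S \<Longrightarrow> fst p \<in> bad \<Longrightarrow> sg * snd p \<le> h0"
    using no_points_over_compact[OF sg \<sigma> bad, of "F ` topspace S"] CH by (auto simp: bad_def)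
  have tmI: "tm \<in> I" using tm(1) ijI by blast
  have "(d tm, \<sigma>) \<in> \<alpha>" unfolding \<alpha> using cd[OF tmI] tmI by (metis imageI)
  moreover have "open (U \<inter> (H2 \<inter> ell a k -` {m - c0/4<..}))" using U openell by blast
  moreover have "d tm \<in> U \<inter> (H2 \<inter> ell a k -` {m - c0/4<..})"
    using K0 KU dH[OF tmI] c0 by (auto simp: m_def)
  ultimately obtain h1 where h1: "\<And>h. h > h1 \<Longrightarrow>
      \<exists>s\<in>topspace S. fst (F s) \<in> U \<inter> (H2 \<inter> ell a k -` {m - c0/4<..}) \<and> snd (F s) = sg * h"
    using surface_reaches_heights[OF cs sg \<sigma>] by metis
  \<comment> \<open>The margin \<open>2\<close> keeps the whole slab of half width \<open>1\<close>
    beyond \<open>h0\<close>.\<close>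
  define h where "h = max h0 h1 + 2"
  define t0 where "t0 = sg * h"
  have hh: "h > h1" "h - 1 > h0" by (auto simp: h_def)
  \<comment> \<open>A reference point in the middle of the slab, where the penalty vanishes; it
    forces the maximum of the barrier above \<open>m - c0/4\<close>.\<close>
  obtain s where s: "s \<in> topspace S" "fst (F s) \<in> U" "ell a k (fst (F s)) > m - c0/4" "snd (F s) = t0"
    using h1[OF hh(1)] by (auto simp: t0_def)
  define M where "M = F ` topspace S \<inter> (C \<times> {t0-1..t0+1})"
  \<comment> \<open>Properness of \<open>F\<close> closes the image in the product, so its part over
    \<open>C\<close> in the slab is compact.\<close>
  have "closedin (top_of_set H2R) (F ` topspace S)"
    using pr by (simp add: proper_map_def closed_map_def)
  then obtain T where T: "closed T" "F ` topspace S = H2R \<inter> T" unfolding closedin_closed by blast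
  have MD: "q \<in> M \<longleftrightarrow> q \<in> F ` topspace S \<and> fst q \<in> C \<and> \<bar>snd q - t0\<bar> \<le> 1" for q
    by (auto simp only: M_def mem_Times_iff Int_iff atLeastAtMost_iff abs_le_iff)
  have "M = (C \<times> {t0-1..t0+1}) \<inter> T" using T CH by (auto simp: M_def H2R_def)
  then have M: "compact M" using T C by (auto intro!: compact_Int_closed compact_Times)
  have sM: "F s \<in> M" unfolding MD using s UC by auto
  have "continuous_on M (\<lambda>p. ell a k (fst p))"
    by (rule continuous_on_compose2[OF contC]) (auto simp only: MD intro!: continuous_intros)
  then have "continuous_on M (barrier a k c0 t0)"
    unfolding barrier_def[abs_def] by (intro continuous_intros)
  then obtain p where p: "p \<in> M" "\<And>q. q \<in> M \<Longrightarrow> barrier a k c0 t0 q \<le> barrier a k c0 t0 p"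
    using continuous_attains_sup[OF M] sM by blast
  have fp: "barrier a k c0 t0 p > m - c0/4"
    using p(2)[OF sM] s by (simp add: barrier_def)
  have pC: "fst p \<in> C" "\<bar>snd p - t0\<bar> \<le> 1" "p \<in> F ` topspace S" using p(1) unfolding MD by auto
  have "sg * (snd p - t0) \<ge> - 1" using pC(2) sg by auto
  moreover have "sg * t0 = h" using sg by (auto simp: t0_def)
  ultimately have "sg * snd p > h0" using hh(2) by (simp add: right_diff_distrib)
  then have nb: "fst p \<notin> bad" using h0[OF pC(3)] by (meson not_le)
  have "0 \<le> c0 * (snd p - t0)\<^sup>2" using c0 by simp
  then have lp: "ell a k (fst p) > m - c0/4" using fp unfolding barrier_def by linarith
  then have pU: "fst p \<in> U" and lp2: "ell a k (fst p) < m + c0/4" using nb pC(1) by (auto simp: bad_def)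
  \<comment> \<open>On the faces of the slab the penalty is \<open>c0\<close>, and the barrier is
    below \<open>m + c0/4 - c0\<close>, less than at the reference point.\<close>
  have "\<bar>snd p - t0\<bar> \<noteq> 1"
  proof
    assume "\<bar>snd p - t0\<bar> = 1"
    then have "(snd p - t0)\<^sup>2 = 1" by (metis one_power2 power2_abs)
    then show False using fp lp2 c0 by (simp add: barrier_def)
  qed
  then have pt: "\<bar>snd p - t0\<bar> < 1" using pC(2) by simp
  obtain s' where s': "s' \<in> topspace S" "p = F s'" using pC(3) by auto
  have "ell a k (fst (F s')) \<le> 4 * c0"
  proof (rule translator_interior_max[OF tr s'(1) _ _ _ c0(1) _ k])
    show "open (U \<times> {t0-1<..<t0+1})" using U by (intro open_Times) auto
    show "F s' \<in> U \<times> {t0-1<..<t0+1}" using pU pt s' by (auto simp: mem_Times_iff abs_less_iff)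
    show "\<bar>snd (F s') - t0\<bar> \<le> 1" using pC s' by simp
    fix s'' assume "s'' \<in> topspace S" "F s'' \<in> U \<times> {t0-1<..<t0+1}"
    then have "F s'' \<in> M" unfolding MD using UC by (auto simp: mem_Times_iff abs_le_iff)
    then show "barrier a k c0 t0 (F s'') \<le> barrier a k c0 t0 (F s')" using p(2) s' by simp
  qed
  then show False using c0 lp m s' by simp
qed

section \<open>Geodesics of the disc\<close>

text \<open>The assumptions say that \<open>(B, A)\<close> is a unit speed curve on the hyperboloid
  equal to its own second derivative, that is a geodesic; \<open>A / (1 + B)\<close> is its
  stereographic projection to the disc.\<close>

lemma hyperboloid_geodesic:
  fixes A A' :: "real \<Rightarrow> complex" and B B' :: "real \<Rightarrow> real"
  assumes A: "\<And>t. (A has_vector_derivative A' t) (at t)" "\<And>t. (A' has_vector_derivative A t) (at t)"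
    and B: "\<And>t. (B has_real_derivative B' t) (at t)" "\<And>t. (B' has_real_derivative B t) (at t)"
    and pos: "\<And>t. B t > 0" and AA: "\<And>t. A t \<bullet> A t = (B t)\<^sup>2 - 1"
    and AA': "\<And>t. A t \<bullet> A' t = B t * B' t" and A'A': "\<And>t. A' t \<bullet> A' t = (B' t)\<^sup>2 + 1"
  shows "is_geodesic H2_metric H2 I (\<lambda>t. (1 / (1 + B t)) *\<^sub>R A t)"
proof -
  define z where "z t = (1 / (1 + B t)) *\<^sub>R A t" for t
  define z' where "z' t = (1 / (1 + B t)) *\<^sub>R A' t - (B' t / (1 + B t)\<^sup>2) *\<^sub>R A t" for t
  have B1: "1 + B t > 0" for t using pos[of t] by simp
  have zz: "1 - z t \<bullet> z t = 2 / (1 + B t)" for t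
  proof -
    have "z t \<bullet> z t = ((B t)\<^sup>2 - 1) / (1 + B t)\<^sup>2" by (simp add: z_def AA power2_eq_square)
    also have "\<dots> = (B t - 1) / (1 + B t)"
      using B1[of t] by (simp add: divide_simps power2_eq_square) (simp add: algebra_simps)
    finally have "1 - z t \<bullet> z t = 1 - (B t - 1) / (1 + B t)" by simp
    also have "\<dots> = 2 / (1 + B t)" using B1[of t] by (simp add: divide_simps)
    finally show ?thesis .
  qed
  have zH: "z t \<in> H2" for t
  proof -
    have "2 / (1 + B t) > 0" using B1[of t] by simp
    then have "(norm (z t))\<^sup>2 < 1" unfolding power2_norm_eq_inner using zz[of t] by linarith
    then show ?thesis by (simp add: H2_norm abs_square_less_1)
  qed
  have Az': "A t \<bullet> z' t = B' t / (1 + B t)" for t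
  proof -
    have "(B' t / (1 + B t)\<^sup>2) * ((B t)\<^sup>2 - 1) = (B' t / (1 + B t)\<^sup>2) * ((1 + B t) * (B t - 1))"
      by (simp add: power2_eq_square algebra_simps)
    also have "\<dots> = B' t * (B t - 1) / (1 + B t)" using B1[of t] by (simp add: power2_eq_square)
    finally have "A t \<bullet> z' t = (B t * B' t) / (1 + B t) - B' t * (B t - 1) / (1 + B t)"
      by (simp add: z'_def inner_diff_right AA AA')
    also have "\<dots> = B' t / (1 + B t)" by (simp add: diff_divide_distrib[symmetric] algebra_simps)
    finally show ?thesis .
  qed
  then have zz': "z t \<bullet> z' t = B' t / (1 + B t)\<^sup>2" for t
    by (simp add: z_def power2_eq_square)
  have z'z': "z' t \<bullet> z' t = 1 / (1 + B t)\<^sup>2" for t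
  proof -
    have "A' t \<bullet> z' t = ((B' t)\<^sup>2 + 1) / (1 + B t) - (B' t / (1 + B t)\<^sup>2) * (B t * B' t)"
      by (simp add: z'_def inner_diff_right A'A' AA' inner_commute[of "A' t" "A t"])
    also have "\<dots> = (1 + B t + (B' t)\<^sup>2) / (1 + B t)\<^sup>2"
      using B1[of t] by (simp add: divide_simps) algebra
    finally have "z' t \<bullet> z' t = (1 + B t + (B' t)\<^sup>2) / (1 + B t)\<^sup>2 / (1 + B t) - (B' t / (1 + B t)\<^sup>2) * (B' t / (1 + B t))"
      by (subst z'_def) (simp add: inner_diff_left Az')
    also have "\<dots> = (1 + B t) / (1 + B t)\<^sup>2 / (1 + B t)"
      by (simp add: diff_divide_distrib[symmetric] power2_eq_square)
    finally show ?thesis using B1[of t] by simp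
  qed
  have d1: "(z has_vector_derivative z' t) (at t)" for t
  proof -
    have "((\<lambda>t. 1 / (1 + B t)) has_real_derivative - B' t / (1 + B t)\<^sup>2) (at t)"
      using B1[of t] by (auto intro!: derivative_eq_intros B simp: power2_eq_square)
    from has_vector_derivative_scaleR[OF this A(1)] show ?thesis
      by (simp add: z_def[abs_def] z'_def)
  qed
  have d2: "(z' has_vector_derivative - christoffel H2_metric (z t) (z' t) (z' t)) (at t)" for t
  proof -
    have 1: "((\<lambda>t. 1 / (1 + B t)) has_real_derivative - B' t / (1 + B t)\<^sup>2) (at t)"
      using B1[of t] by (auto intro!: derivative_eq_intros B simp: power2_eq_square)
    have 2: "((\<lambda>t. B' t / (1 + B t)\<^sup>2) has_real_derivative
        (B t * (1 + B t)\<^sup>2 - B' t * (2 * (1 + B t) * B' t)) / ((1 + B t)\<^sup>2 * (1 + B t)\<^sup>2)) (at t)"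
      using B1[of t] by (auto intro!: derivative_eq_intros B simp: power2_eq_square)
    \<comment> \<open>The derivative of \<open>z'\<close> and the connection term are both
      combinations of \<open>A t\<close> and \<open>A' t\<close>: \<open>4\<close> collects the
      coefficients, and \<open>e1\<close> and \<open>e2\<close> match them, the latter by way of
      \<open>5\<close>.\<close>
    have 4: "- D *\<^sub>R (p *\<^sub>R (q *\<^sub>R X - r *\<^sub>R Y) - s *\<^sub>R (q *\<^sub>R Y))
        = (- D * p * q) *\<^sub>R X + (D * p * r + D * s * q) *\<^sub>R Y" for D p q r s and X Y :: complex
      by (simp add: complex_eq_iff algebra_simps)
    have 5: "D * (2 * (q / D\<^sup>2)) * (q / D\<^sup>2) + D * (1 / D\<^sup>2) * (1 / D)
        = 1 / D - ((D - 1) * D\<^sup>2 - q * (2 * D * q)) / (D\<^sup>2 * D\<^sup>2)" if "D > 0" for D q :: real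
      using that by (simp add: divide_simps power2_eq_square) (simp add: algebra_simps)
    have 3: "2 / (2 / (1 + B t)) = 1 + B t" by simp
    define p R where "p = B' t / (1 + B t)\<^sup>2"
      and "R = (B t * (1 + B t)\<^sup>2 - B' t * (2 * (1 + B t) * B' t)) / ((1 + B t)\<^sup>2 * (1 + B t)\<^sup>2)"
    have e1: "- (1 + B t) * (2 * p) * (1 / (1 + B t)) = - p - p"
      using B1[of t] by (simp add: field_simps)
    have e2: "(1 + B t) * (2 * p) * p + (1 + B t) * (1 / (1 + B t)\<^sup>2) * (1 / (1 + B t)) = 1 / (1 + B t) - R"
      unfolding p_def R_def using 5[of "1 + B t" "B' t"] B1[of t] by (simp only: add_diff_cancel_left')
    have "- christoffel H2_metric (z t) (z' t) (z' t)
      = - (1 + B t) *\<^sub>R ((2 * p) *\<^sub>R z' t - (1 / (1 + B t)\<^sup>2) *\<^sub>R z t)"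
      unfolding christoffel_H2[OF zH] H2_gamma_def power2_norm_eq_inner zz zz' z'z' 3 p_def
      by (simp only: scaleR_minus_left scaleR_left_distrib mult_2)
    also have "\<dots> = (- p - p) *\<^sub>R A' t + (1 / (1 + B t) - R) *\<^sub>R A t"
      unfolding z_def z'_def p_def[symmetric] 4 e1 e2 ..
    also have "\<dots> = (1 / (1 + B t)) *\<^sub>R A t + (- p) *\<^sub>R A' t - (p *\<^sub>R A' t + R *\<^sub>R A t)"
      by (simp add: complex_eq_iff algebra_simps)
    finally have eq: "- christoffel H2_metric (z t) (z' t) (z' t) =
        (1 / (1 + B t)) *\<^sub>R A t + (- B' t / (1 + B t)\<^sup>2) *\<^sub>R A' t
       - ((B' t / (1 + B t)\<^sup>2) *\<^sub>R A' t +
         ((B t * (1 + B t)\<^sup>2 - B' t * (2 * (1 + B t) * B' t)) / ((1 + B t)\<^sup>2 * (1 + B t)\<^sup>2)) *\<^sub>R A t)"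
      by (simp only: p_def R_def minus_divide_left)
    show ?thesis
      unfolding eq unfolding z'_def
      by (intro has_vector_derivative_diff has_vector_derivative_scaleR 1 2 A)
  qed
  have z'0: "z' t \<noteq> 0" for t using z'z'[of t] B1[of t] by auto
  have "is_geodesic H2_metric H2 I z"
    unfolding is_geodesic_def
  proof (intro conjI exI[of _ z'] ballI)
    show "z ` I \<subseteq> H2" using zH by blast
  qed (rule z'0 has_vector_derivative_at_within[OF d1] has_vector_derivative_at_within[OF d2])+
  then show ?thesis by (simp only: z_def[abs_def])
qed

text \<open>For a unit vector \<open>e\<close>, the projected hyperboloid geodesic on which the
  functional with coefficients \<open>b\<close> and \<open>sqrt (1 + b^2) e\<close>
  vanishes.\<close>

definition hgeo :: "real \<Rightarrow> complex \<Rightarrow> real \<Rightarrow> complex" where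
  "hgeo b e t = (1 / (1 + sqrt (1 + b\<^sup>2) * cosh t)) *\<^sub>R (e * Complex (- b * cosh t) (sinh t))"

lemma hgeo_is_geodesic:
  assumes e: "norm e = 1"
  shows "is_geodesic H2_metric H2 I (hgeo b e)"
proof -
  define r where "r = sqrt (1 + b\<^sup>2)"
  have r: "r > 0" "r\<^sup>2 = 1 + b\<^sup>2" by (auto simp: r_def add_pos_nonneg)
  have in1: "(e * x) \<bullet> (e * y) = x \<bullet> y" for x y
  proof -
    have "(Re e)\<^sup>2 + (Im e)\<^sup>2 = 1" using e by (metis cmod_power2 one_power2)
    moreover have "(e * x) \<bullet> (e * y) = ((Re e)\<^sup>2 + (Im e)\<^sup>2) * (x \<bullet> y)"
      by (simp add: inner_complex_def power2_eq_square algebra_simps)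
    ultimately show ?thesis by simp
  qed
  have cs: "(cosh t)\<^sup>2 = (sinh t)\<^sup>2 + 1" for t :: real by (simp add: cosh_square_eq)
  have "is_geodesic H2_metric H2 I (\<lambda>t. (1 / (1 + r * cosh t)) *\<^sub>R (e * Complex (- b * cosh t) (sinh t)))"
  proof (rule hyperboloid_geodesic[where A' = "\<lambda>t. e * Complex (- b * sinh t) (cosh t)" and B' = "\<lambda>t. r * sinh t"])
    fix t :: real
    show "((\<lambda>t. e * Complex (- b * cosh t) (sinh t)) has_vector_derivative e * Complex (- b * sinh t) (cosh t)) (at t)"
      unfolding Complex_eq by (auto intro!: derivative_eq_intros has_vector_derivative_of_real simp: field_simps)
    show "((\<lambda>t. e * Complex (- b * sinh t) (cosh t)) has_vector_derivative e * Complex (- b * cosh t) (sinh t)) (at t)"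
      unfolding Complex_eq by (auto intro!: derivative_eq_intros has_vector_derivative_of_real simp: field_simps)
    show "((\<lambda>t. r * cosh t) has_real_derivative r * sinh t) (at t)"
      "((\<lambda>t. r * sinh t) has_real_derivative r * cosh t) (at t)"
      by (auto intro!: derivative_eq_intros)
    show "r * cosh t > 0" using r by (simp add: cosh_real_pos)
    show "(e * Complex (- b * cosh t) (sinh t)) \<bullet> (e * Complex (- b * cosh t) (sinh t)) = (r * cosh t)\<^sup>2 - 1"
      unfolding in1 by (simp add: inner_complex_def power_mult_distrib r cs[unfolded power2_eq_square] algebra_simps
          flip: power2_eq_square) (simp add: cs algebra_simps)?
    show "(e * Complex (- b * cosh t) (sinh t)) \<bullet> (e * Complex (- b * sinh t) (cosh t)) = r * cosh t * (r * sinh t)"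
      using r(2) unfolding in1 by (simp add: inner_complex_def power2_eq_square) algebra
    show "(e * Complex (- b * sinh t) (cosh t)) \<bullet> (e * Complex (- b * sinh t) (cosh t)) = (r * sinh t)\<^sup>2 + 1"
      using r(2) cs[of t] unfolding in1 by (simp add: inner_complex_def power2_eq_square) algebra
  qed
  then show ?thesis by (simp add: hgeo_def[abs_def] r_def)
qed

text \<open>The argument of \<open>arsinh\<close> is the component of the hyperboloid point along
  \<open>\<i> * e\<close>, which is \<open>sinh t\<close> on \<open>hgeo b e\<close>.\<close>

definition hcoord :: "complex \<Rightarrow> complex \<Rightarrow> real" where
  "hcoord e z = arsinh (2 * Im (cnj e * z) / (1 - (norm z)\<^sup>2))"

text \<open>The component along \<open>\<i> * e\<close> fixes \<open>sinh t\<close>. The vanishing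
  functional and the equation of the hyperboloid then determine \<open>cosh t\<close> and the
  component along \<open>e\<close>.\<close>

lemma hgeo_hcoord:
  assumes e: "norm e = 1" and z: "z \<in> H2"
    and zero: "b * (1 + (norm z)\<^sup>2) + 2 * sqrt (1 + b\<^sup>2) * (e \<bullet> z) = 0"
  shows "hgeo b e (hcoord e z) = z"
proof -
  define w where "w = cnj e * z"
  define x y q r where "x = Re w" and "y = Im w" and "q = (norm z)\<^sup>2" and "r = sqrt (1 + b\<^sup>2)"
  have r: "r > 0" "r\<^sup>2 = 1 + b\<^sup>2" by (auto simp: r_def add_pos_nonneg)
  have ee: "e * cnj e = 1" using e by (metis complex_norm_square of_real_1 one_power2)
  have zw: "z = e * w" unfolding w_def using ee by (simp add: mult.assoc[symmetric])
  have q: "q = x\<^sup>2 + y\<^sup>2"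
    unfolding q_def x_def y_def cmod_power2[symmetric] using e by (simp add: zw norm_mult)
  have ez: "e \<bullet> z = x" by (simp add: x_def w_def inner_complex_def)
  have q1: "1 - q > 0" using H2_pos[OF z] by (simp add: q_def)
  define t where "t = hcoord e z"
  have sh: "sinh t = 2 * y / (1 - q)" by (simp add: t_def hcoord_def y_def w_def q_def sinh_arsinh_real)
  have lin: "b * (1 + q) + 2 * r * x = 0" using zero by (simp add: ez q_def r_def)
  have ch: "cosh t = (1 + q) / ((1 - q) * r)"
  proof -
    \<comment> \<open>Here \<open>(1 - q)^2 + 4 y^2 = (1 + q)^2 - 4 x^2\<close>, and
      \<open>lin\<close> turns \<open>4 r^2 x^2\<close> into \<open>b^2 (1 + q)^2\<close>.\<close>
    have "r\<^sup>2 * ((1 - q)\<^sup>2 + 4 * y\<^sup>2) = (1 + q)\<^sup>2"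
      using lin r(2) q by algebra
    then have "1 + (2 * y / (1 - q))\<^sup>2 = ((1 + q) / ((1 - q) * r))\<^sup>2"
      using q1 r(1) by (simp add: divide_simps power_mult_distrib) (simp add: algebra_simps)?
    then have "(cosh t)\<^sup>2 = ((1 + q) / ((1 - q) * r))\<^sup>2" using sh by (simp add: cosh_square_eq)
    moreover have "(1 + q) / ((1 - q) * r) \<ge> 0" using q1 r(1) by (simp add: q_def)
    ultimately show ?thesis by (simp add: power2_eq_iff_nonneg cosh_real_nonneg)
  qed
  have den: "1 / (1 + r * cosh t) = (1 - q) / 2" using q1 r(1) by (simp add: ch divide_simps)
  have "(1 - q) / 2 * (- b * cosh t) = x"
    using q1 r(1) lin by (simp add: ch divide_simps) algebra?
  moreover have "(1 - q) / 2 * sinh t = y" using q1 by (simp add: sh)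
  ultimately have "((1 - q) / 2) *\<^sub>R Complex (- b * cosh t) (sinh t) = w"
    by (simp add: complex_eq_iff x_def y_def)
  then show ?thesis
    unfolding hgeo_def t_def[symmetric] r_def[symmetric] den by (simp add: zw) (metis mult_scaleR_right)?
qed

lemma continuous_on_hcoord: "continuous_on H2 (hcoord e)"
proof -
  have "continuous_on H2 (\<lambda>z. 2 * Im (cnj e * z) / (1 - (norm z)\<^sup>2))"
    by (intro continuous_on_divide continuous_intros) (use H2_pos in force)
  then show ?thesis
    unfolding hcoord_def[abs_def] by (intro continuous_on_compose2[OF continuous_on_arsinh[of UNIV]]) auto
qed

section \<open>Functionals vanishing at given points of the disc\<close>

lemma functional_spacelike:
  assumes "z \<in> H2" "ell a k z = 0" "k \<noteq> 0"
  shows "a\<^sup>2 < (norm k)\<^sup>2"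
proof (rule ccontr)
  assume "\<not> ?thesis"
  then have le: "norm k \<le> \<bar>a\<bar>" by (simp add: abs_le_square_iff[symmetric] not_less)
  \<comment> \<open>A nonzero functional vanishing at a timelike vector is spacelike: otherwise
    Cauchy-Schwarz leaves \<open>|a| (1 - |z|)^2\<close> nonpositive.\<close>
  have "a * (1 + (norm z)\<^sup>2) = - 2 * (k \<bullet> z)" using assms(2) H2_pos[OF assms(1)] by (simp add: ell_def)
  then have "\<bar>a\<bar> * (1 + (norm z)\<^sup>2) = 2 * \<bar>k \<bullet> z\<bar>"
    by (metis abs_mult abs_minus_cancel abs_numeral abs_of_nonneg add_nonneg_nonneg zero_le_one zero_le_power2 mult_minus_left)
  also have "\<dots> \<le> 2 * (norm k * norm z)" using Cauchy_Schwarz_ineq2 by simp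
  also have "\<dots> \<le> 2 * (\<bar>a\<bar> * norm z)" using le by (simp add: mult_right_mono)
  finally have "\<bar>a\<bar> * (1 - norm z)\<^sup>2 \<le> 0" by (simp add: power2_eq_square algebra_simps)
  moreover have "\<bar>a\<bar> > 0" using le assms(3) by (metis norm_le_zero_iff not_le order_trans)
  moreover have "(1 - norm z)\<^sup>2 > 0" using assms(1) by (simp add: H2_norm)
  ultimately show False by (simp add: mult_le_0_iff)
qed

text \<open>Dividing the functional by its Minkowski norm \<open>s\<close> brings it to the form
  belonging to \<open>hgeo\<close>. On \<open>C\<close> the map \<open>hcoord\<close> is then
  inverted by \<open>hgeo\<close>, so the parameter set is a connected subset of the line with two
  distinct points.\<close>

lemma geodesic_arc_of_zeros:
  assumes C: "C \<subseteq> H2" "connected C" "x \<in> C" "y \<in> C" "x \<noteq> y"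
    and k: "a\<^sup>2 < (norm k)\<^sup>2" and zero: "\<And>z. z \<in> C \<Longrightarrow> ell a k z = 0"
  shows "geodesic_arc H2_metric H2 C"
proof -
  define s where "s = sqrt ((norm k)\<^sup>2 - a\<^sup>2)"
  have s: "s > 0" "s\<^sup>2 = (norm k)\<^sup>2 - a\<^sup>2" using k by (auto simp: s_def)
  have nk: "norm k > 0" using k by (metis norm_eq_zero not_less power_zero_numeral zero_le_power2 zero_less_norm_iff)
  define b and e where "b = a / s" and "e = (1 / norm k) *\<^sub>R k"
  have e: "norm e = 1" using nk by (simp add: e_def)
  have "1 + b\<^sup>2 = (norm k / s)\<^sup>2"
    using s(1) s(2) by (simp add: b_def power_divide field_simps)
  then have r: "sqrt (1 + b\<^sup>2) = norm k / s" using s nk by (simp add: real_sqrt_unique)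
  have inv: "hgeo b e (hcoord e z) = z" if "z \<in> C" for z
  proof (rule hgeo_hcoord[OF e])
    show "z \<in> H2" using that C by blast
    then have "a * (1 + (norm z)\<^sup>2) + 2 * (k \<bullet> z) = 0"
      using zero[OF that] H2_pos[of z] by (simp add: ell_def)
    moreover have "b * (1 + (norm z)\<^sup>2) + 2 * sqrt (1 + b\<^sup>2) * (e \<bullet> z) = (a * (1 + (norm z)\<^sup>2) + 2 * (k \<bullet> z)) / s"
      unfolding r using nk by (simp add: b_def e_def add_divide_distrib)
    ultimately show "b * (1 + (norm z)\<^sup>2) + 2 * sqrt (1 + b\<^sup>2) * (e \<bullet> z) = 0" by simp
  qed
  define I where "I = hcoord e ` C"
  have "connected I" unfolding I_def
    by (intro connected_continuous_image continuous_on_subset[OF continuous_on_hcoord] C)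
  then have "is_interval I" by (simp add: is_interval_connected_1)
  moreover have "hcoord e x \<noteq> hcoord e y" using inv C by metis
  then have "\<exists>u\<in>I. \<exists>v\<in>I. u < v" unfolding I_def using C by (metis image_eqI linorder_neqE_linordered_idom)
  ultimately have "nontrivial_interval I" by (simp add: nontrivial_interval_def)
  moreover have "C = hgeo b e ` I" using inv by (force simp: I_def)
  ultimately show ?thesis
    using hgeo_is_geodesic[OF e] unfolding geodesic_arc_def by blast
qed

text \<open>\<open>hdet x y z\<close> is a quarter of the determinant of the vectors \<open>(1 + |p|\<^sup>2, 2p)\<close>, \<open>p = x, y, z\<close>; up to positive
  factors these are the points of the hyperboloid over \<open>x, y, z\<close>.\<close>

definition hdet :: "complex \<Rightarrow> complex \<Rightarrow> complex \<Rightarrow> real" where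
  "hdet x y z = (1 + (norm z)\<^sup>2) * Im (cnj x * y) + (1 + (norm x)\<^sup>2) * Im (cnj y * z) +
     (1 + (norm y)\<^sup>2) * Im (cnj z * x)"

text \<open>Space part of a quarter of the cross product of the two vectors over \<open>x\<close>
  and \<open>y\<close>; the time part is \<open>Im (cnj x * y)\<close>.\<close>

definition hnormal :: "complex \<Rightarrow> complex \<Rightarrow> complex" where
  "hnormal x y = (\<i> * ((1 + (norm x)\<^sup>2) *\<^sub>R y - (1 + (norm y)\<^sup>2) *\<^sub>R x)) / 2"

lemma hdet_ell: "ell (Im (cnj x * y)) (hnormal x y) z = hdet x y z / (1 - (norm z)\<^sup>2)"
proof -
  have "2 * (hnormal x y \<bullet> z) = (1 + (norm x)\<^sup>2) * Im (cnj y * z) + (1 + (norm y)\<^sup>2) * Im (cnj z * x)"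
    by (simp add: hnormal_def inner_complex_def field_simps)
  then show ?thesis by (simp add: ell_def hdet_def algebra_simps)
qed

lemma hdet_degenerate: "hdet x y x = 0" "hdet x y y = 0"
  by (simp_all add: hdet_def algebra_simps)

lemma hdet_permute: "hdet x y z = - hdet x z y" "hdet x y z = - hdet z y x"
  by (simp_all add: hdet_def algebra_simps)

text \<open>Equality of \<open>x / (1 + |x|^2)\<close> and \<open>y / (1 + |y|^2)\<close> forces
  \<open>|x| = |y|\<close>, because \<open>p / (1 + p^2)\<close> is injective on
  \<open>[0, 1)\<close>.\<close>

lemma hnormal_nonzero:
  assumes "x \<in> H2" "y \<in> H2" "x \<noteq> y"
  shows "hnormal x y \<noteq> 0"
proof
  define p q where "p = norm x" and "q = norm y"
  have pq: "0 \<le> p" "0 \<le> q" "p < 1" "q < 1" using assms by (auto simp: p_def q_def H2_norm)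
  assume "hnormal x y = 0"
  then have eq: "(1 + p\<^sup>2) *\<^sub>R y = (1 + q\<^sup>2) *\<^sub>R x" by (simp add: hnormal_def p_def q_def)
  have pos: "1 + p\<^sup>2 > 0" "1 + q\<^sup>2 > 0" by (auto simp: add_pos_nonneg)
  have "(1 + p\<^sup>2) * q = (1 + q\<^sup>2) * p"
    using arg_cong[OF eq, of norm] pos by (simp add: p_def q_def abs_of_pos)
  then have "(q - p) * (1 - p * q) = 0" by (simp add: power2_eq_square algebra_simps)
  moreover have "p * q < 1" using pq mult_right_mono[of p 1 q] by simp
  ultimately have "p = q" by simp
  then have "x = y" using eq pos by simp
  then show False using assms by simp
qed

lemma ell_minus: "ell (- a) (- k) z = - ell a k z"
  by (simp add: ell_def add_divide_distrib diff_divide_distrib)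

section \<open>From the one-sided bounds to a single geodesic\<close>

theorem theorem2:
  fixes S :: "'a topology" and \<A> :: "'a parametrizations" and F :: "'a \<Rightarrow> complex \<times> real"
    and \<sigma> :: ereal and \<alpha> :: "(complex \<times> ereal) set"
  assumes "translator S \<A> F"
    and "complete_immersion H2R_metric S F"
    and "proper_map S (top_of_set H2R) F"
    and "\<sigma> \<in> {\<infinity>, -\<infinity>}"
    and "\<alpha> \<subseteq> horizontal_boundary \<sigma> (F ` topspace S)"
    and "properly_embedded_arc (H2 \<times> {\<sigma>}) \<alpha>"
    and "closure (horizontal_boundary \<sigma> (F ` topspace S) - \<alpha>) \<inter> \<alpha> = {}"
    and "continuous_surface_with_boundary S F \<alpha>"
  shows "geodesic_arc H2_metric H2 (fst ` \<alpha>)"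
proof -
  obtain sg :: real where sg: "sg \<in> {1, -1}" and \<sigma>: "\<sigma> = ereal sg * \<infinity>"
  proof (cases "\<sigma> = \<infinity>")
    case True
    then show ?thesis by (intro that[of 1]) auto
  next
    case False
    then show ?thesis using assms(4) by (intro that[of "-1"]) auto
  qed
  obtain I c where I: "nontrivial_interval I"
    and c: "continuous_map (top_of_set I) (top_of_set (H2 \<times> {\<sigma>})) c"
      "proper_map (top_of_set I) (top_of_set (H2 \<times> {\<sigma>})) c" "inj_on c I" and \<alpha>: "\<alpha> = c ` I"
    using assms(6) unfolding properly_embedded_arc_def by blast
  have intI: "is_interval I" using I by (simp add: nontrivial_interval_def)
  define d where "d t = fst (c t)" for t
  have cH: "c t \<in> H2 \<times> {\<sigma>}" if "t \<in> I" for t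
    using continuous_map_image_subset_topspace[OF c(1)] that by auto
  then have dH: "d t \<in> H2" if "t \<in> I" for t using that by (auto simp: d_def mem_Times_iff)
  have dinj: "d s \<noteq> d t" if "s \<in> I" "t \<in> I" "s \<noteq> t" for s t
    using cH[OF that(1)] cH[OF that(2)] inj_onD[OF c(3) _ that(1,2)] that(3)
    by (auto simp: d_def mem_Times_iff prod_eq_iff)
  \<comment> \<open>The functional through the end points of a subarc and its negative are both
    nonpositive on the subarc, so the subarc lies on their common zero set.\<close>
  have three: "hdet (d i) (d j) (d t) = 0" if ij: "i \<in> I" "j \<in> I" "i < j" and t: "t \<in> {i..j}" for i j t
  proof -
    define a k where "a = Im (cnj (d i) * d j)" and "k = hnormal (d i) (d j)"
    have zero: "ell a k (d i) = 0" "ell a k (d j) = 0"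
      by (simp_all only: a_def k_def hdet_ell hdet_degenerate div_0)
    have k0: "k \<noteq> 0" unfolding k_def using hnormal_nonzero dH dinj ij by simp
    have ak: "a\<^sup>2 < (norm k)\<^sup>2" by (rule functional_spacelike[OF dH[OF ij(1)] zero(1) k0])
    note below = arc_below[OF assms(1,3) sg \<sigma> assms(7,8) intI c \<alpha> ij(1,2) _ _ _ t, folded d_def]
    have "ell a k (d t) \<le> 0" by (rule below[OF zero ak])
    moreover have "ell (- a) (- k) (d t) \<le> 0"
      by (rule below) (use zero ak in \<open>simp_all add: ell_minus\<close>)
    ultimately have "ell a k (d t) = 0" by (simp add: ell_minus)
    moreover have "t \<in> I" using mem_is_interval_1_I[OF intI ij(1,2)] t by auto
    ultimately show ?thesis
      using H2_pos[OF dH, of t] unfolding a_def k_def hdet_ell by simp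
  qed
  obtain i j where ij: "i \<in> I" "j \<in> I" "i < j" using I by (auto simp: nontrivial_interval_def)
  \<comment> \<open>The geodesic through two fixed points contains the rest of the arc as well:
    among three parameters one lies between the others, and \<open>hdet\<close> changes only its
    sign when its arguments are swapped.\<close>
  have all: "hdet (d i) (d j) (d t) = 0" if "t \<in> I" for t
  proof -
    consider "t < i" | "t \<in> {i..j}" | "j < t" by fastforce
    then show ?thesis
    proof cases
      case 1
      then have "hdet (d t) (d j) (d i) = 0" using that ij by (intro three) auto
      then show ?thesis by (simp add: hdet_permute(2)[of "d i" "d j" "d t"])
    next
      case 2
      then show ?thesis using ij by (intro three)
    next
      case 3
      then have "hdet (d i) (d t) (d j) = 0" using that ij by (intro three) auto
      then show ?thesis by (simp add: hdet_permute(1)[of "d i" "d j" "d t"])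
    qed
  qed
  have C: "fst ` \<alpha> = d ` I" by (simp add: \<alpha> d_def image_image)
  define a k where "a = Im (cnj (d i) * d j)" and "k = hnormal (d i) (d j)"
  have zero: "ell a k z = 0" if "z \<in> d ` I" for z
    using that all unfolding a_def k_def hdet_ell by auto
  have "continuous_on I c" using c(1) by (simp add: continuous_map_in_subtopology)
  then have "continuous_on I d" unfolding d_def by (rule continuous_on_fst)
  then have conn: "connected (d ` I)"
    by (rule connected_continuous_image) (use intI in \<open>simp add: is_interval_connected\<close>)
  have k0: "k \<noteq> 0" unfolding k_def using hnormal_nonzero dH dinj ij by simp
  have ak: "a\<^sup>2 < (norm k)\<^sup>2" using functional_spacelike[OF dH[OF ij(1)] _ k0] zero ij by blast
  show ?thesis
    unfolding C
  proof (rule geodesic_arc_of_zeros[OF _ conn _ _ _ ak zero])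
    show "d ` I \<subseteq> H2" using dH by blast
    show "d i \<in> d ` I" "d j \<in> d ` I" "d i \<noteq> d j" using ij dinj by auto
  qed
qed

end
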